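(* Let $\mathcal U\subset\mathcal P(\mathbb N)$ be a family of infinite subsets of $\mathbb N$ such that: (i) $\mathcal U$ is closed under finite intersections and under finite modifications of its elements; (ii) there exist $X_\xi\in\mathcal U$, $\xi<\omega_1$, such that for any $X\in\mathcal U$ there exists $\xi$ with $X_\xi\subset^* X$; (iii) for any $f\in\mathbb N^{\mathbb N}$ there exists $X\in\mathcal U$ such that $f(i)\le n(X,i)$ for all but finitely many $i$. Let $\mathcal F=(\mathbf F_X)_{X\in\mathcal U}$ be the inverse system with respect to the inclusion maps and $\mathcal G=(\mathbf G_X)_{X\in\mathcal U}$ the inverse system with respect to the quotient maps. Then the first derived inverse limit $\varprojlim^1\mathcal F$ is isomorphic to $\varprojlim\mathcal G/\operatorname{im}(\mathbb T^{\mathbb N})$, where $\operatorname{im}(\mathbb T^{\mathbb N})$ is the image of the diagonal map $\mathbb T^{\mathbb N}\to\varprojlim\mathcal G$, $\alpha\mapsto([\alpha]_{\mathbf F_X})_{X\in\mathcal U}$.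
   Context: $\mathbb N$ includes $0$; $\mathbb T$ is the unit circle in $\mathbb C$, and $\mathbb T^{\mathbb N}$ is a group under pointwise multiplication. $Y\subset^*X$ means that $Y\setminus X$ is finite. For an infinite $X\subset\mathbb N$ and $j\in\mathbb N$, $n(X,j)$ denotes the $j$-th element (counting from $j=0$, so $n(X,0)=0$) in the increasing enumeration of $\{0\}\cup X$, and $I(X,j)=[\,n(X,j),n(X,j+1)\,)$. For finite $I\subset\mathbb N$ and $\alpha,\beta\in\mathbb T^{\mathbb N}$ let $\Delta_I(\alpha,\beta)=\max_{i,j\in I}|\alpha(i)\overline{\alpha(j)}-\beta(i)\overline{\beta(j)}|$. For infinite $X\subset\mathbb N$ let $\mathbf F_X=\{\alpha\in\mathbb T^{\mathbb N}:\lim_{j\to\infty}\Delta_{I(X,j)\cup I(X,j+1)}(\alpha,1)=0\}$ and $\mathbf G_X=\mathbb T^{\mathbb N}/\mathbf F_X$ (discrete groups). If $Y\subset^*X$ then $\mathbf F_Y\subset\mathbf F_X$, giving an inclusion $\mathbf F_Y\to\mathbf F_X$ and a quotient map $\mathbf G_Y\to\mathbf G_X$; the systems are indexed by $\mathcal U$ directed by $\supset^*$ (smaller sets come later). $\varprojlim^n$ denotes the $n$-th right derived functor of the left-exact functor $\varprojlim$ on the category of inverse systems of abelian groups indexed by a fixed directed set, computed as the cohomology $H^n$ of the cochain obtained by applying $\varprojlim$ to an injective resolution. *)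

theory Defs
  imports Complex_Main "HOL-Library.Infinite_Set" "HOL-Algebra.Product_Groups"
begin

section \<open>Inverse systems of abelian groups and the derived functors of the limit\<close>

text \<open>
  Indices range over a set \<open>J\<close> preordered by \<open>below\<close>. For \<open>below x y\<close> the transition map
  \<open>tr A x y\<close> goes from \<open>grp A y\<close> to \<open>grp A x\<close>.
\<close>

record ('i, 'a) inv_sys =
  grp :: "'i \<Rightarrow> 'a monoid"
  tr :: "'i \<Rightarrow> 'i \<Rightarrow> 'a \<Rightarrow> 'a"

definition inv_system :: "'i set \<Rightarrow> ('i \<Rightarrow> 'i \<Rightarrow> bool) \<Rightarrow> ('i, 'a) inv_sys \<Rightarrow> bool" where
  "inv_system J below A \<longleftrightarrow>
     (\<forall>x\<in>J. comm_group (grp A x)) \<and>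
     (\<forall>x\<in>J. \<forall>y\<in>J. below x y \<longrightarrow> tr A x y \<in> hom (grp A y) (grp A x)) \<and>
     (\<forall>x\<in>J. \<forall>a\<in>carrier (grp A x). tr A x x a = a) \<and>
     (\<forall>x\<in>J. \<forall>y\<in>J. \<forall>z\<in>J. below x y \<longrightarrow> below y z \<longrightarrow>
        (\<forall>a\<in>carrier (grp A z). tr A x y (tr A y z a) = tr A x z a))"

definition system_hom ::
  "'i set \<Rightarrow> ('i \<Rightarrow> 'i \<Rightarrow> bool) \<Rightarrow> ('i, 'a) inv_sys \<Rightarrow> ('i, 'b) inv_sys \<Rightarrow> ('i \<Rightarrow> 'a \<Rightarrow> 'b) \<Rightarrow> bool" where
  "system_hom J below A B f \<longleftrightarrow>
     (\<forall>x\<in>J. f x \<in> hom (grp A x) (grp B x)) \<and>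
     (\<forall>x\<in>J. \<forall>y\<in>J. below x y \<longrightarrow>
        (\<forall>a\<in>carrier (grp A y). f x (tr A x y a) = tr B x y (f y a)))"

text \<open>Monomorphisms and exactness in the category of inverse systems are pointwise.\<close>

definition system_mono ::
  "'i set \<Rightarrow> ('i \<Rightarrow> 'i \<Rightarrow> bool) \<Rightarrow> ('i, 'a) inv_sys \<Rightarrow> ('i, 'b) inv_sys \<Rightarrow> ('i \<Rightarrow> 'a \<Rightarrow> 'b) \<Rightarrow> bool" where
  "system_mono J below A B f \<longleftrightarrow>
     system_hom J below A B f \<and> (\<forall>x\<in>J. inj_on (f x) (carrier (grp A x)))"

text \<open>
  Injective objects of the category of inverse systems. HOL cannot quantify over all types, so
  the test systems \<open>B\<close>, \<open>C\<close> live on the same type as \<open>I\<close>. This loses nothing as soon as that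
  type is infinite (in particular whenever an infinite group embeds into a component of \<open>I\<close>):
  see the lemma \<open>injective_system_extends\<close> below, which is Baer's criterion for systems.
\<close>

definition injective_system ::
  "'i set \<Rightarrow> ('i \<Rightarrow> 'i \<Rightarrow> bool) \<Rightarrow> ('i, 'b) inv_sys \<Rightarrow> bool" where
  "injective_system J below I \<longleftrightarrow> inv_system J below I \<and>
     (\<forall>(B :: ('i, 'b) inv_sys) (C :: ('i, 'b) inv_sys) m f.
        inv_system J below B \<longrightarrow> inv_system J below C \<longrightarrow> system_mono J below B C m \<longrightarrow>
        system_hom J below B I f \<longrightarrow>
        (\<exists>g. system_hom J below C I g \<and>
             (\<forall>x\<in>J. \<forall>b\<in>carrier (grp B x). g x (m x b) = f x b)))"

definition injective_resolution ::
  "'i set \<Rightarrow> ('i \<Rightarrow> 'i \<Rightarrow> bool) \<Rightarrow> ('i, 'a) inv_sys \<Rightarrow> ('i \<Rightarrow> 'a \<Rightarrow> 'b) \<Rightarrow>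
   (nat \<Rightarrow> ('i, 'b) inv_sys) \<Rightarrow> (nat \<Rightarrow> 'i \<Rightarrow> 'b \<Rightarrow> 'b) \<Rightarrow> bool" where
  "injective_resolution J below A \<epsilon> I d \<longleftrightarrow>
     (\<forall>n. injective_system J below (I n)) \<and>
     (\<forall>n. system_hom J below (I n) (I (Suc n)) (d n)) \<and>
     system_mono J below A (I 0) \<epsilon> \<and>
     (\<forall>x\<in>J. \<epsilon> x ` carrier (grp A x) = kernel (grp (I 0) x) (grp (I 1) x) (d 0 x)) \<and>
     (\<forall>n. \<forall>x\<in>J. d n x ` carrier (grp (I n) x) =
        kernel (grp (I (Suc n)) x) (grp (I (Suc (Suc n))) x) (d (Suc n) x))"

definition inv_lim :: "'i set \<Rightarrow> ('i \<Rightarrow> 'i \<Rightarrow> bool) \<Rightarrow> ('i, 'a) inv_sys \<Rightarrow> ('i \<Rightarrow> 'a) monoid" where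
  "inv_lim J below A = (product_group J (grp A))
     \<lparr>carrier := {s \<in> carrier (product_group J (grp A)).
        \<forall>x\<in>J. \<forall>y\<in>J. below x y \<longrightarrow> tr A x y (s y) = s x}\<rparr>"

definition lim_map :: "'i set \<Rightarrow> ('i \<Rightarrow> 'a \<Rightarrow> 'b) \<Rightarrow> ('i \<Rightarrow> 'a) \<Rightarrow> ('i \<Rightarrow> 'b)" where
  "lim_map J f s = (\<lambda>x\<in>J. f x (s x))"

definition cohomology ::
  "(nat \<Rightarrow> 'c monoid) \<Rightarrow> (nat \<Rightarrow> 'c \<Rightarrow> 'c) \<Rightarrow> nat \<Rightarrow> 'c set monoid" where
  "cohomology C \<delta> n =
     (C n)\<lparr>carrier := kernel (C n) (C (Suc n)) (\<delta> n)\<rparr> Mod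
     (case n of 0 \<Rightarrow> {\<one>\<^bsub>C 0\<^esub>} | Suc k \<Rightarrow> \<delta> k ` carrier (C k))"

text \<open>
  The \<open>n\<close>-th derived limit of a system, computed from an injective resolution \<open>I\<close>, \<open>d\<close> of it.
\<close>

definition derived_lim ::
  "'i set \<Rightarrow> ('i \<Rightarrow> 'i \<Rightarrow> bool) \<Rightarrow> (nat \<Rightarrow> ('i, 'b) inv_sys) \<Rightarrow> (nat \<Rightarrow> 'i \<Rightarrow> 'b \<Rightarrow> 'b) \<Rightarrow> nat \<Rightarrow>
   ('i \<Rightarrow> 'b) set monoid" where
  "derived_lim J below I d n = cohomology (\<lambda>k. inv_lim J below (I k)) (\<lambda>k. lim_map J (d k)) n"

subsection \<open>Independence of injectivity from the type of the test systems\<close>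

lemma inv_systemD:
  assumes "inv_system J below A"
  shows "x \<in> J \<Longrightarrow> comm_group (grp A x)"
    and "\<lbrakk>x \<in> J; y \<in> J; below x y\<rbrakk> \<Longrightarrow> tr A x y \<in> hom (grp A y) (grp A x)"
    and "\<lbrakk>x \<in> J; a \<in> carrier (grp A x)\<rbrakk> \<Longrightarrow> tr A x x a = a"
    and "\<lbrakk>x \<in> J; y \<in> J; z \<in> J; below x y; below y z; a \<in> carrier (grp A z)\<rbrakk>
          \<Longrightarrow> tr A x y (tr A y z a) = tr A x z a"
  using assms unfolding inv_system_def by blast+

lemma system_homD:
  assumes "system_hom J below A B f"
  shows "x \<in> J \<Longrightarrow> f x \<in> hom (grp A x) (grp B x)"
    and "\<lbrakk>x \<in> J; y \<in> J; below x y; a \<in> carrier (grp A y)\<rbrakk> \<Longrightarrow> f x (tr A x y a) = tr B x y (f y a)"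
  using assms unfolding system_hom_def by blast+

lemma transported_int_group:
  fixes \<iota> :: "int \<Rightarrow> 'b"
  assumes \<iota>: "inj \<iota>" and "0 \<in> K" "\<And>a b. a \<in> K \<Longrightarrow> b \<in> K \<Longrightarrow> a + b \<in> K" "\<And>a. a \<in> K \<Longrightarrow> - a \<in> K"
  shows "comm_group \<lparr>carrier = \<iota> ` K,
    monoid.mult = (\<lambda>a b. \<iota> (the_inv \<iota> a + the_inv \<iota> b)), one = \<iota> 0\<rparr>"
proof (rule comm_groupI, goal_cases)
  case (6 a)
  then obtain k where k: "k \<in> K" "a = \<iota> k" by auto
  show ?case using k assms by (intro bexI[of _ "\<iota> (- k)"]) (auto simp: the_inv_f_f)
qed (use assms in \<open>auto simp: the_inv_f_f ac_simps\<close>)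

theorem injective_system_extends:
  fixes I :: "('i, 'b) inv_sys" and B :: "('i, 'c) inv_sys" and C :: "('i, 'd) inv_sys"
  assumes inj: "injective_system J below I" and inf: "infinite (UNIV :: 'b set)"
    and refl: "\<And>x. x \<in> J \<Longrightarrow> below x x"
    and trans: "\<And>x y z. \<lbrakk>x \<in> J; y \<in> J; z \<in> J; below x y; below y z\<rbrakk> \<Longrightarrow> below x z"
    and B: "inv_system J below B" and C: "inv_system J below C"
    and m: "system_mono J below B C m" and f: "system_hom J below B I f"
  shows "\<exists>g. system_hom J below C I g \<and> (\<forall>x\<in>J. \<forall>b\<in>carrier (grp B x). g x (m x b) = f x b)"
proof -
  obtain \<iota> :: "int \<Rightarrow> 'b" where \<iota>: "inj \<iota>"
  proof -
    obtain h :: "nat \<Rightarrow> 'b" where h: "inj h"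
      using inf infinite_countable_subset by blast
    have "inj (h \<circ> to_nat :: int \<Rightarrow> 'b)" by (intro inj_compose h) auto
    then show thesis using that by blast
  qed
  have I: "inv_system J below I"
    using inj unfolding injective_system_def by blast
  have mh: "system_hom J below B C m" and mi: "\<And>x. x \<in> J \<Longrightarrow> inj_on (m x) (carrier (grp B x))"
    using m unfolding system_mono_def by blast+
  note BD = inv_systemD[OF B] and CD = inv_systemD[OF C] and ID = inv_systemD[OF I]
  note mD = system_homD[OF mh] and fD = system_homD[OF f]
  have grpB: "group (grp B x)" if "x \<in> J" for x using BD(1)[OF that] by (simp add: comm_group.axioms)
  have grpC: "group (grp C x)" if "x \<in> J" for x using CD(1)[OF that] by (simp add: comm_group.axioms)
  have grpI: "group (grp I x)" if "x \<in> J" for x using ID(1)[OF that] by (simp add: comm_group.axioms)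
  \<comment> \<open>Partial extensions of \<open>f\<close>, represented by their graphs.\<close>
  define P where "P R \<longleftrightarrow>
     R \<subseteq> {(x, c, e). x \<in> J \<and> c \<in> carrier (grp C x) \<and> e \<in> carrier (grp I x)} \<and>
     (\<forall>x b. x \<in> J \<longrightarrow> b \<in> carrier (grp B x) \<longrightarrow> (x, m x b, f x b) \<in> R) \<and>
     (\<forall>x c e c' e'. (x, c, e) \<in> R \<longrightarrow> (x, c', e') \<in> R \<longrightarrow>
        (x, c \<otimes>\<^bsub>grp C x\<^esub> c', e \<otimes>\<^bsub>grp I x\<^esub> e') \<in> R) \<and>
     (\<forall>x c e. (x, c, e) \<in> R \<longrightarrow> (x, inv\<^bsub>grp C x\<^esub> c, inv\<^bsub>grp I x\<^esub> e) \<in> R) \<and>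
     (\<forall>x c e y. (x, c, e) \<in> R \<longrightarrow> y \<in> J \<longrightarrow> below y x \<longrightarrow> (y, tr C y x c, tr I y x e) \<in> R) \<and>
     (\<forall>x e. (x, \<one>\<^bsub>grp C x\<^esub>, e) \<in> R \<longrightarrow> e = \<one>\<^bsub>grp I x\<^esub>)" for R
  have PD: "(x, c, e) \<in> R \<Longrightarrow> x \<in> J \<and> c \<in> carrier (grp C x) \<and> e \<in> carrier (grp I x)"
    "x \<in> J \<Longrightarrow> b \<in> carrier (grp B x) \<Longrightarrow> (x, m x b, f x b) \<in> R"
    "(x, c, e) \<in> R \<Longrightarrow> (x, c', e') \<in> R \<Longrightarrow> (x, c \<otimes>\<^bsub>grp C x\<^esub> c', e \<otimes>\<^bsub>grp I x\<^esub> e') \<in> R"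
    "(x, c, e) \<in> R \<Longrightarrow> (x, inv\<^bsub>grp C x\<^esub> c, inv\<^bsub>grp I x\<^esub> e) \<in> R"
    "(x, c, e) \<in> R \<Longrightarrow> y \<in> J \<Longrightarrow> below y x \<Longrightarrow> (y, tr C y x c, tr I y x e) \<in> R"
    "(x, \<one>\<^bsub>grp C x\<^esub>, e) \<in> R \<Longrightarrow> e = \<one>\<^bsub>grp I x\<^esub>"
    if "P R" for R x c e b c' e' y
    using that unfolding P_def by blast+
  have Psv: "e = e'" if R: "P R" and "(x, c, e) \<in> R" "(x, c, e') \<in> R" for R x c e e'
  proof -
    have 1: "x \<in> J" "c \<in> carrier (grp C x)" "e \<in> carrier (grp I x)" "e' \<in> carrier (grp I x)"
      using PD(1)[OF R] that(2,3) by blast+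
    interpret gC: group "grp C x" by (rule grpC[OF 1(1)])
    interpret gI: group "grp I x" by (rule grpI[OF 1(1)])
    have "(x, c \<otimes>\<^bsub>grp C x\<^esub> inv\<^bsub>grp C x\<^esub> c, e \<otimes>\<^bsub>grp I x\<^esub> inv\<^bsub>grp I x\<^esub> e') \<in> R"
      using PD(3,4)[OF R] that by blast
    then have "e \<otimes>\<^bsub>grp I x\<^esub> inv\<^bsub>grp I x\<^esub> e' = \<one>\<^bsub>grp I x\<^esub>"
      using PD(6)[OF R] 1 by simp
    then show ?thesis using 1 gI.inv_equality gI.inv_inv by fastforce
  qed
  define R0 where "R0 = {(x, m x b, f x b) |x b. x \<in> J \<and> b \<in> carrier (grp B x)}"
  have "P R0"
    unfolding P_def
  proof (intro conjI allI impI)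
    show "R0 \<subseteq> {(x, c, e). x \<in> J \<and> c \<in> carrier (grp C x) \<and> e \<in> carrier (grp I x)}"
      using hom_in_carrier[OF mD(1)] hom_in_carrier[OF fD(1)] by (auto simp: R0_def)
  next
    fix x c e c' e' assume "(x, c, e) \<in> R0" "(x, c', e') \<in> R0"
    then obtain b b' where b: "x \<in> J" "b \<in> carrier (grp B x)" "b' \<in> carrier (grp B x)"
      "c = m x b" "e = f x b" "c' = m x b'" "e' = f x b'" by (auto simp: R0_def)
    interpret gB: group "grp B x" by (rule grpB[OF b(1)])
    have "(x, m x (b \<otimes>\<^bsub>grp B x\<^esub> b'), f x (b \<otimes>\<^bsub>grp B x\<^esub> b')) \<in> R0"
      using b by (auto simp: R0_def)
    then show "(x, c \<otimes>\<^bsub>grp C x\<^esub> c', e \<otimes>\<^bsub>grp I x\<^esub> e') \<in> R0"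
      using b mD(1)[OF b(1)] fD(1)[OF b(1)] by (simp add: hom_mult)
  next
    fix x c e assume "(x, c, e) \<in> R0"
    then obtain b where b: "x \<in> J" "b \<in> carrier (grp B x)" "c = m x b" "e = f x b"
      by (auto simp: R0_def)
    interpret m: group_hom "grp B x" "grp C x" "m x"
      using grpB grpC mD(1) b(1) by (simp add: group_hom_def group_hom_axioms_def)
    interpret f: group_hom "grp B x" "grp I x" "f x"
      using grpB grpI fD(1) b(1) by (simp add: group_hom_def group_hom_axioms_def)
    have "(x, m x (inv\<^bsub>grp B x\<^esub> b), f x (inv\<^bsub>grp B x\<^esub> b)) \<in> R0"
      using m.G.inv_closed[OF b(2)] b(1) unfolding R0_def by blast
    then show "(x, inv\<^bsub>grp C x\<^esub> c, inv\<^bsub>grp I x\<^esub> e) \<in> R0" using b by simp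
  next
    fix x c e y assume "(x, c, e) \<in> R0" and y: "y \<in> J" "below y x"
    then obtain b where b: "x \<in> J" "b \<in> carrier (grp B x)" "c = m x b" "e = f x b"
      by (auto simp: R0_def)
    have "tr B y x b \<in> carrier (grp B y)" using BD(2)[of y x] b y by (auto simp: hom_def)
    then have "(y, m y (tr B y x b), f y (tr B y x b)) \<in> R0"
      using y by (auto simp: R0_def)
    then show "(y, tr C y x c, tr I y x e) \<in> R0" using b y mD(2) fD(2) by simp
  next
    fix x e assume "(x, \<one>\<^bsub>grp C x\<^esub>, e) \<in> R0"
    then obtain b where b: "x \<in> J" "b \<in> carrier (grp B x)" "\<one>\<^bsub>grp C x\<^esub> = m x b" "e = f x b"
      by (auto simp: R0_def)
    interpret m: group_hom "grp B x" "grp C x" "m x"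
      using grpB grpC mD(1) b(1) by (simp add: group_hom_def group_hom_axioms_def)
    interpret f: group_hom "grp B x" "grp I x" "f x"
      using grpB grpI fD(1) b(1) by (simp add: group_hom_def group_hom_axioms_def)
    have "m x b = m x \<one>\<^bsub>grp B x\<^esub>" using b(3) by simp
    then have "b = \<one>\<^bsub>grp B x\<^esub>" using mi[OF b(1)] b(2) by (meson inj_onD m.G.one_closed)
    then show "e = \<one>\<^bsub>grp I x\<^esub>" using b by simp
  qed (auto simp: R0_def)
  have "\<exists>M\<in>{R. P R}. \<forall>X\<in>{R. P R}. M \<subseteq> X \<longrightarrow> X = M"
  proof (rule subset_Zorn_nonempty)
    show "{R. P R} \<noteq> {}" using \<open>P R0\<close> by blast
  next
    fix \<C> assume ne: "\<C> \<noteq> {}" and ch: "subset.chain {R. P R} \<C>"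
    have PC: "P R" if "R \<in> \<C>" for R using ch that by (auto simp: subset_chain_def)
    have two: "\<exists>R\<in>\<C>. s \<in> R \<and> t \<in> R" if "s \<in> \<Union>\<C>" "t \<in> \<Union>\<C>" for s t
      using that ch unfolding subset_chain_def by blast
    have "P (\<Union>\<C>)"
      unfolding P_def
    proof (intro conjI allI impI)
      show "\<Union>\<C> \<subseteq> {(x, c, e). x \<in> J \<and> c \<in> carrier (grp C x) \<and> e \<in> carrier (grp I x)}"
        using PD(1)[OF PC] by fast
    next
      fix x b assume "x \<in> J" "b \<in> carrier (grp B x)"
      then show "(x, m x b, f x b) \<in> \<Union>\<C>" using ne PD(2)[OF PC] by blast
    next
      fix x c e c' e' assume "(x, c, e) \<in> \<Union>\<C>" "(x, c', e') \<in> \<Union>\<C>"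
      then obtain R where "R \<in> \<C>" "(x, c, e) \<in> R" "(x, c', e') \<in> R" using two by blast
      then show "(x, c \<otimes>\<^bsub>grp C x\<^esub> c', e \<otimes>\<^bsub>grp I x\<^esub> e') \<in> \<Union>\<C>" using PD(3)[OF PC] by blast
    next
      fix x c e assume "(x, c, e) \<in> \<Union>\<C>"
      then show "(x, inv\<^bsub>grp C x\<^esub> c, inv\<^bsub>grp I x\<^esub> e) \<in> \<Union>\<C>" using PD(4)[OF PC] by blast
    next
      fix x c e y assume "(x, c, e) \<in> \<Union>\<C>" "y \<in> J" "below y x"
      then show "(y, tr C y x c, tr I y x e) \<in> \<Union>\<C>" using PD(5)[OF PC] by blast
    next
      fix x e assume "(x, \<one>\<^bsub>grp C x\<^esub>, e) \<in> \<Union>\<C>"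
      then show "e = \<one>\<^bsub>grp I x\<^esub>" using PD(6)[OF PC] by blast
    qed
    then show "\<Union>\<C> \<in> {R. P R}" by simp
  qed
  then obtain R where R: "P R" and Rmax: "\<And>R'. P R' \<Longrightarrow> R \<subseteq> R' \<Longrightarrow> R' = R" by blast
  note RD = PD[OF R]
  have "\<exists>e. (x, c, e) \<in> R" if x: "x \<in> J" and c: "c \<in> carrier (grp C x)" for x c
  proof -
    define N where "N y = (if below y x then UNIV else {0 :: int})" for y
    define h where "h y n = (if below y x then tr C y x c [^]\<^bsub>grp C y\<^esub> n else \<one>\<^bsub>grp C y\<^esub>)"
      for y and n :: int
    have N: "0 \<in> N y" "a \<in> N y \<Longrightarrow> b \<in> N y \<Longrightarrow> a + b \<in> N y" "a \<in> N y \<Longrightarrow> - a \<in> N y" for y a b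
      by (auto simp: N_def)
    have Nmono: "a \<in> N z" if "a \<in> N y" "y \<in> J" "z \<in> J" "below z y" for a y z
      using that trans[of z y x] x by (auto simp: N_def split: if_splits)
    have trc: "tr C y x c \<in> carrier (grp C y)" if "y \<in> J" "below y x" for y
      using CD(2)[of y x] that x c by (auto simp: hom_def)
    have hc: "h y n \<in> carrier (grp C y)" if "y \<in> J" for y n
      using group.int_pow_closed[OF grpC[OF that] trc[OF that]] monoid.one_closed[OF group.is_monoid[OF grpC[OF that]]]
      by (simp add: h_def)
    have h0: "h y 0 = \<one>\<^bsub>grp C y\<^esub>" if "y \<in> J" for y
      by (simp add: h_def)
    have hadd: "h y (a + b) = h y a \<otimes>\<^bsub>grp C y\<^esub> h y b" if y: "y \<in> J" for y a b
    proof -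
      interpret gC: group "grp C y" by (rule grpC[OF y])
      show ?thesis using trc[OF y] by (simp add: h_def gC.int_pow_mult)
    qed
    have hneg: "h y (- a) = inv\<^bsub>grp C y\<^esub> (h y a)" if y: "y \<in> J" for y a
    proof -
      interpret gC: group "grp C y" by (rule grpC[OF y])
      show ?thesis using trc[OF y] by (simp add: h_def gC.int_pow_neg)
    qed
    have htr: "tr C z y (h y a) = h z a"
      if "y \<in> J" "z \<in> J" "below z y" "a \<in> N y" for y z a
    proof -
      interpret t: group_hom "grp C y" "grp C z" "tr C z y"
        using grpC CD(2) that by (simp add: group_hom_def group_hom_axioms_def)
      show ?thesis
      proof (cases "below y x")
        case True
        then have "below z x" using trans[of z y x] that x by blast
        then show ?thesis using True trc that x c CD(4)[of z y x c]
          by (simp add: h_def t.hom_int_pow)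
      next
        case False
        then show ?thesis using that by (simp add: N_def h_def)
      qed
    qed
    define G where "G K = \<lparr>carrier = \<iota> ` K, monoid.mult = (\<lambda>a b. \<iota> (the_inv \<iota> a + the_inv \<iota> b)), one = \<iota> 0\<rparr>"
      for K
    define K where "K y = {n \<in> N y. \<exists>e. (y, h y n, e) \<in> R}" for y
    define k where "k y a = (THE e. (y, h y (the_inv \<iota> a), e) \<in> R)" for y a
    have k: "k y (\<iota> n) = e" if "(y, h y n, e) \<in> R" for y n e
      using that Psv[OF R] by (auto simp: k_def the_inv_f_f[OF \<iota>])
    have kR: "(y, h y n, k y (\<iota> n)) \<in> R" if "n \<in> K y" for y n
      using that k by (auto simp: K_def)
    have one: "(y, \<one>\<^bsub>grp C y\<^esub>, \<one>\<^bsub>grp I y\<^esub>) \<in> R" if y: "y \<in> J" for y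
    proof -
      interpret m: group_hom "grp B y" "grp C y" "m y"
        using grpB grpC mD(1) y by (simp add: group_hom_def group_hom_axioms_def)
      interpret f: group_hom "grp B y" "grp I y" "f y"
        using grpB grpI fD(1) y by (simp add: group_hom_def group_hom_axioms_def)
      show ?thesis using RD(2)[OF y m.G.one_closed] by simp
    qed
    have K: "0 \<in> K y" "a \<in> K y \<Longrightarrow> b \<in> K y \<Longrightarrow> a + b \<in> K y" "a \<in> K y \<Longrightarrow> - a \<in> K y"
      if y: "y \<in> J" for y a b
      using one[OF y] h0[OF y] RD(3)[of y "h y a" _ "h y b"] RD(4)[of y "h y a"] N
      by (auto simp: K_def hadd[OF y] hneg[OF y])
    define PN where "PN = \<lparr>grp = (\<lambda>y. G (N y)), tr = (\<lambda>_ _ a. a)\<rparr>"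
    define PK where "PK = \<lparr>grp = (\<lambda>y. G (K y)), tr = (\<lambda>_ _ a. a)\<rparr>"
    have Kmono: "a \<in> K z" if "a \<in> K y" "y \<in> J" "z \<in> J" "below z y" for a y z
    proof -
      obtain e where "a \<in> N y" "(y, h y a, e) \<in> R" using \<open>a \<in> K y\<close> by (auto simp: K_def)
      then have "(z, h z a, tr I z y e) \<in> R" using RD(5)[of y "h y a" e z] htr that by simp
      then show ?thesis using Nmono \<open>a \<in> N y\<close> that by (auto simp: K_def)
    qed
    have homG: "id \<in> hom (G X) (G Y)" if "X \<subseteq> Y" for X Y
      using that by (auto simp: hom_def G_def)
    have PN: "inv_system J below PN"
      unfolding inv_system_def using transported_int_group[OF \<iota>, of "N _"] N Nmono
      by (auto simp: PN_def G_def hom_def)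
    have PK: "inv_system J below PK"
      unfolding inv_system_def using transported_int_group[OF \<iota>, of "K _"] K Kmono
      by (auto simp: PK_def G_def hom_def)
    have mono: "system_mono J below PK PN (\<lambda>_ a. a)"
      unfolding system_mono_def system_hom_def
      by (auto simp: PK_def PN_def G_def hom_def K_def)
    have kh: "system_hom J below PK I k"
      unfolding system_hom_def
    proof (intro conjI ballI impI)
      fix y assume y: "y \<in> J"
      show "k y \<in> hom (grp PK y) (grp I y)"
      proof (rule homI)
        fix a assume "a \<in> carrier (grp PK y)"
        then show "k y a \<in> carrier (grp I y)"
          using RD(1)[OF kR] by (auto simp: PK_def G_def)
      next
        fix a b assume "a \<in> carrier (grp PK y)" "b \<in> carrier (grp PK y)"
        then obtain a' b' where ab: "a' \<in> K y" "b' \<in> K y" "a = \<iota> a'" "b = \<iota> b'"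
          by (auto simp: PK_def G_def)
        have "(y, h y (a' + b'), k y a \<otimes>\<^bsub>grp I y\<^esub> k y b) \<in> R"
          using RD(3)[OF kR[OF ab(1)] kR[OF ab(2)]] ab hadd[OF y] by simp
        then show "k y (a \<otimes>\<^bsub>grp PK y\<^esub> b) = k y a \<otimes>\<^bsub>grp I y\<^esub> k y b"
          using k ab by (simp add: PK_def G_def the_inv_f_f[OF \<iota>])
      qed
    next
      fix z y a assume zy: "z \<in> J" "y \<in> J" "below z y" and "a \<in> carrier (grp PK y)"
      then obtain a' where a: "a' \<in> K y" "a = \<iota> a'" by (auto simp: PK_def G_def)
      then have "a' \<in> N y" by (simp add: K_def)
      then have "(z, h z a', tr I z y (k y a)) \<in> R"
        using RD(5)[OF kR[OF a(1)] zy(1,3)] htr zy a by simp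
      then show "k z (tr PK z y a) = tr I z y (k y a)" using k a by (simp add: PK_def)
    qed
    obtain g where g: "system_hom J below PN I g"
      and gk: "\<And>y a. y \<in> J \<Longrightarrow> a \<in> carrier (grp PK y) \<Longrightarrow> g y a = k y a"
      using inj[unfolded injective_system_def, THEN conjunct2, rule_format, OF PK PN mono kh] by blast
    define q where "q y n = g y (\<iota> n)" for y and n :: int
    have qhom: "group_hom (G (N y)) (grp I y) (g y)" if y: "y \<in> J" for y
      using inv_systemD(1)[OF PN y] grpI[OF y] system_homD(1)[OF g y]
      by (simp add: group_hom_def group_hom_axioms_def PN_def comm_group.axioms)
    have qc: "q y n \<in> carrier (grp I y)" if "y \<in> J" "n \<in> N y" for y n
      using group_hom.hom_closed[OF qhom] that by (simp add: q_def G_def)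
    have qadd: "q y (a + b) = q y a \<otimes>\<^bsub>grp I y\<^esub> q y b" if "y \<in> J" "a \<in> N y" "b \<in> N y" for y a b
      using group_hom.hom_mult[OF qhom, of y "\<iota> a" "\<iota> b"] that
      by (simp add: q_def G_def the_inv_f_f[OF \<iota>])
    have q0: "q y 0 = \<one>\<^bsub>grp I y\<^esub>" if "y \<in> J" for y
      using group_hom.hom_one[OF qhom, of y] that by (simp add: q_def G_def)
    have qneg: "q y (- a) = inv\<^bsub>grp I y\<^esub> (q y a)" if "y \<in> J" "a \<in> N y" for y a
    proof -
      interpret gI: group "grp I y" by (rule grpI[OF that(1)])
      have "q y (- a) \<otimes>\<^bsub>grp I y\<^esub> q y a = \<one>\<^bsub>grp I y\<^esub>"
        using qadd[of y "- a" a] q0 that N(3) by simp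
      then show ?thesis using gI.inv_equality qc that N(3) by metis
    qed
    have qtr: "tr I z y (q y a) = q z a" if "y \<in> J" "z \<in> J" "below z y" "a \<in> N y" for y z a
      using system_homD(2)[OF g, of z y "\<iota> a"] that by (simp add: q_def PN_def G_def)
    have qR: "e = q y n" if "(y, h y n, e) \<in> R" "n \<in> N y" for y n e
    proof -
      have "\<iota> n \<in> carrier (grp PK y)" using that by (auto simp: PK_def G_def K_def)
      then show ?thesis using gk k[OF that(1)] RD(1)[OF that(1)] by (simp add: q_def)
    qed
    define R' where "R' = {(y, d \<otimes>\<^bsub>grp C y\<^esub> h y n, e \<otimes>\<^bsub>grp I y\<^esub> q y n) |y d e n. (y, d, e) \<in> R \<and> n \<in> N y}"
    have sub: "R \<subseteq> R'"
    proof
      fix t assume t: "t \<in> R"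
      obtain y d e where tt: "t = (y, d, e)" by (cases t)
      have 1: "y \<in> J" "d \<in> carrier (grp C y)" "e \<in> carrier (grp I y)" using RD(1) t tt by auto
      then have "t = (y, d \<otimes>\<^bsub>grp C y\<^esub> h y 0, e \<otimes>\<^bsub>grp I y\<^esub> q y 0)"
        using tt h0 q0 grpC[OF 1(1)] grpI[OF 1(1)]
        by (simp add: monoid.r_one group.is_monoid)
      moreover have "(y, d, e) \<in> R" using t tt by simp
      ultimately show "t \<in> R'" using N(1) unfolding R'_def by blast
    qed
    have "P R'"
      unfolding P_def
    proof (intro conjI allI impI)
      show "R' \<subseteq> {(x, c, e). x \<in> J \<and> c \<in> carrier (grp C x) \<and> e \<in> carrier (grp I x)}"
      proof
        fix t assume "t \<in> R'"
        then obtain y d e n where t: "t = (y, d \<otimes>\<^bsub>grp C y\<^esub> h y n, e \<otimes>\<^bsub>grp I y\<^esub> q y n)"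
          "(y, d, e) \<in> R" "n \<in> N y" unfolding R'_def by blast
        then show "t \<in> {(x, c, e). x \<in> J \<and> c \<in> carrier (grp C x) \<and> e \<in> carrier (grp I x)}"
          using RD(1)[OF t(2)] hc qc grpC grpI by (auto intro!: monoid.m_closed group.is_monoid)
      qed
    next
      fix y b assume "y \<in> J" "b \<in> carrier (grp B y)"
      then show "(y, m y b, f y b) \<in> R'" using RD(2) sub by blast
    next
      fix y c1 e1 c2 e2 assume "(y, c1, e1) \<in> R'" "(y, c2, e2) \<in> R'"
      then obtain d1 u1 n1 d2 u2 n2 where
        1: "(y, d1, u1) \<in> R" "n1 \<in> N y" "c1 = d1 \<otimes>\<^bsub>grp C y\<^esub> h y n1" "e1 = u1 \<otimes>\<^bsub>grp I y\<^esub> q y n1" and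
        2: "(y, d2, u2) \<in> R" "n2 \<in> N y" "c2 = d2 \<otimes>\<^bsub>grp C y\<^esub> h y n2" "e2 = u2 \<otimes>\<^bsub>grp I y\<^esub> q y n2"
        unfolding R'_def by blast
      have y: "y \<in> J" using RD(1) 1 by blast
      interpret gC: comm_group "grp C y" by (rule CD(1)[OF y])
      interpret gI: comm_group "grp I y" by (rule ID(1)[OF y])
      have "(y, (d1 \<otimes>\<^bsub>grp C y\<^esub> d2) \<otimes>\<^bsub>grp C y\<^esub> h y (n1 + n2), (u1 \<otimes>\<^bsub>grp I y\<^esub> u2) \<otimes>\<^bsub>grp I y\<^esub> q y (n1 + n2)) \<in> R'"
        using RD(3)[OF 1(1) 2(1)] N(2)[OF 1(2) 2(2)] unfolding R'_def by blast
      moreover have "(d1 \<otimes>\<^bsub>grp C y\<^esub> d2) \<otimes>\<^bsub>grp C y\<^esub> h y (n1 + n2) = c1 \<otimes>\<^bsub>grp C y\<^esub> c2"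
        using RD(1)[OF 1(1)] RD(1)[OF 2(1)] hc 1 2 by (simp add: hadd y gC.m_ac)
      moreover have "(u1 \<otimes>\<^bsub>grp I y\<^esub> u2) \<otimes>\<^bsub>grp I y\<^esub> q y (n1 + n2) = e1 \<otimes>\<^bsub>grp I y\<^esub> e2"
        using RD(1)[OF 1(1)] RD(1)[OF 2(1)] qc 1 2 by (simp add: qadd y gI.m_ac)
      ultimately show "(y, c1 \<otimes>\<^bsub>grp C y\<^esub> c2, e1 \<otimes>\<^bsub>grp I y\<^esub> e2) \<in> R'" by simp
    next
      fix y c1 e1 assume "(y, c1, e1) \<in> R'"
      then obtain d1 u1 n1 where
        1: "(y, d1, u1) \<in> R" "n1 \<in> N y" "c1 = d1 \<otimes>\<^bsub>grp C y\<^esub> h y n1" "e1 = u1 \<otimes>\<^bsub>grp I y\<^esub> q y n1"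
        unfolding R'_def by blast
      have y: "y \<in> J" using RD(1) 1 by blast
      interpret gC: comm_group "grp C y" by (rule CD(1)[OF y])
      interpret gI: comm_group "grp I y" by (rule ID(1)[OF y])
      have "(y, inv\<^bsub>grp C y\<^esub> d1 \<otimes>\<^bsub>grp C y\<^esub> h y (- n1), inv\<^bsub>grp I y\<^esub> u1 \<otimes>\<^bsub>grp I y\<^esub> q y (- n1)) \<in> R'"
        using RD(4)[OF 1(1)] N(3)[OF 1(2)] unfolding R'_def by blast
      then show "(y, inv\<^bsub>grp C y\<^esub> c1, inv\<^bsub>grp I y\<^esub> e1) \<in> R'"
        using RD(1)[OF 1(1)] hc qc 1 y by (simp add: hneg qneg gC.inv_mult gI.inv_mult)
    next
      fix y c1 e1 z assume "(y, c1, e1) \<in> R'" and z: "z \<in> J" "below z y"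
      then obtain d1 u1 n1 where
        1: "(y, d1, u1) \<in> R" "n1 \<in> N y" "c1 = d1 \<otimes>\<^bsub>grp C y\<^esub> h y n1" "e1 = u1 \<otimes>\<^bsub>grp I y\<^esub> q y n1"
        unfolding R'_def by blast
      have y: "y \<in> J" using RD(1) 1 by blast
      have "(z, tr C z y d1 \<otimes>\<^bsub>grp C z\<^esub> h z n1, tr I z y u1 \<otimes>\<^bsub>grp I z\<^esub> q z n1) \<in> R'"
        using RD(5)[OF 1(1) z] Nmono[OF 1(2) y z] unfolding R'_def by blast
      then show "(z, tr C z y c1, tr I z y e1) \<in> R'"
        using RD(1)[OF 1(1)] hc qc 1 y z htr qtr
          hom_mult[OF CD(2)[OF z(1) y z(2)], of d1 "h y n1"]
          hom_mult[OF ID(2)[OF z(1) y z(2)], of u1 "q y n1"] by simp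
    next
      fix y e1 assume "(y, \<one>\<^bsub>grp C y\<^esub>, e1) \<in> R'"
      then obtain d1 u1 n1 where
        1: "(y, d1, u1) \<in> R" "n1 \<in> N y" "\<one>\<^bsub>grp C y\<^esub> = d1 \<otimes>\<^bsub>grp C y\<^esub> h y n1" "e1 = u1 \<otimes>\<^bsub>grp I y\<^esub> q y n1"
        unfolding R'_def by blast
      have y: "y \<in> J" and d1: "d1 \<in> carrier (grp C y)" and u1: "u1 \<in> carrier (grp I y)"
        using RD(1) 1 by blast+
      interpret gC: comm_group "grp C y" by (rule CD(1)[OF y])
      interpret gI: comm_group "grp I y" by (rule ID(1)[OF y])
      have "inv\<^bsub>grp C y\<^esub> (h y n1) = d1" using gC.inv_equality 1(3) d1 hc[OF y] by metis
      then have "(y, h y (- n1), u1) \<in> R" using 1(1) by (simp add: hneg y)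
      then have "u1 = q y (- n1)" using qR N(3) 1(2) by blast
      then show "e1 = \<one>\<^bsub>grp I y\<^esub>" using 1 y qc qneg by simp
    qed
    then have R'R: "R' = R" using Rmax sub by blast
    have xx: "below x x" by (rule refl[OF x])
    interpret gC: group "grp C x" by (rule grpC[OF x])
    have "h x 1 = c" using xx c CD(3)[OF x c] by (simp add: h_def gC.int_pow_1)
    moreover have "1 \<in> N x" using xx by (simp add: N_def)
    ultimately have "(x, \<one>\<^bsub>grp C x\<^esub> \<otimes>\<^bsub>grp C x\<^esub> c, \<one>\<^bsub>grp I x\<^esub> \<otimes>\<^bsub>grp I x\<^esub> q x 1) \<in> R'"
      using one[OF x] unfolding R'_def by blast
    then show ?thesis using R'R c by auto
  qed
  then have ex: "\<And>x c. x \<in> J \<Longrightarrow> c \<in> carrier (grp C x) \<Longrightarrow> \<exists>e. (x, c, e) \<in> R" .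
  define g where "g x c = (THE e. (x, c, e) \<in> R)" for x c
  have gI: "g x c = e" if "(x, c, e) \<in> R" for x c e
    using that Psv[OF R] by (auto simp: g_def)
  have gR: "(x, c, g x c) \<in> R" if "x \<in> J" "c \<in> carrier (grp C x)" for x c
    using ex[OF that] gI by auto
  have "system_hom J below C I g"
    unfolding system_hom_def hom_def
    using RD(1)[OF gR] gI[OF RD(3)[OF gR gR]] gI[OF RD(5)[OF gR]] by auto
  moreover have "\<forall>x\<in>J. \<forall>b\<in>carrier (grp B x). g x (m x b) = f x b"
    using gI RD(2) by blast
  ultimately show ?thesis by blast
qed

section \<open>The systems F and G\<close>

text \<open>
  The \<open>j\<close>-th element of \<open>{0} \<union> X\<close> in increasing order is \<open>enumerate (insert 0 X) j\<close>.
\<close>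

definition nth_pt :: "nat set \<Rightarrow> nat \<Rightarrow> nat" where
  "nth_pt X j = enumerate (insert 0 X) j"

definition seg :: "nat set \<Rightarrow> nat \<Rightarrow> nat set" where
  "seg X j = {nth_pt X j ..< nth_pt X (Suc j)}"

definition Delta :: "nat set \<Rightarrow> (nat \<Rightarrow> complex) \<Rightarrow> (nat \<Rightarrow> complex) \<Rightarrow> real" where
  "Delta K \<alpha> \<beta> =
     Max {cmod (\<alpha> i * cnj (\<alpha> j) - \<beta> i * cnj (\<beta> j)) |i j. i \<in> K \<and> j \<in> K}"

definition TN :: "(nat \<Rightarrow> complex) monoid" where
  "TN = \<lparr>carrier = {\<alpha>. \<forall>n. cmod (\<alpha> n) = 1}, monoid.mult = (\<lambda>\<alpha> \<beta> n. \<alpha> n * \<beta> n), one = (\<lambda>_. 1)\<rparr>"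

definition F_set :: "nat set \<Rightarrow> (nat \<Rightarrow> complex) set" where
  "F_set X = {\<alpha> \<in> carrier TN.
     (\<lambda>j. Delta (seg X j \<union> seg X (Suc j)) \<alpha> (\<lambda>_. 1)) \<longlonglongrightarrow> 0}"

text \<open>
  \<open>almost_sup X Y\<close> says that \<open>Y \<setminus> X\<close> is finite, that is \<open>X \<supset>* Y\<close>: smaller sets come later in
  the directed index set.
\<close>

definition almost_sup :: "nat set \<Rightarrow> nat set \<Rightarrow> bool" where
  "almost_sup X Y \<longleftrightarrow> finite (Y - X)"

definition F_sys :: "(nat set, nat \<Rightarrow> complex) inv_sys" where
  "F_sys = \<lparr>grp = (\<lambda>X. TN\<lparr>carrier := F_set X\<rparr>), tr = (\<lambda>X Y \<alpha>. \<alpha>)\<rparr>"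

text \<open>
  An element of \<open>grp G_sys Y\<close> is a coset \<open>c\<close> of \<open>F_set Y\<close>; the quotient map sends it to the
  coset \<open>F_set X c\<close> of the larger subgroup \<open>F_set X\<close>.
\<close>

definition G_sys :: "(nat set, (nat \<Rightarrow> complex) set) inv_sys" where
  "G_sys = \<lparr>grp = (\<lambda>X. TN Mod F_set X), tr = (\<lambda>X Y c. F_set X <#>\<^bsub>TN\<^esub> c)\<rparr>"

definition diag :: "nat set set \<Rightarrow> (nat \<Rightarrow> complex) \<Rightarrow> nat set \<Rightarrow> (nat \<Rightarrow> complex) set" where
  "diag U \<alpha> = (\<lambda>X\<in>U. F_set X #>\<^bsub>TN\<^esub> \<alpha>)"

end

theory Submission
  imports Defs
begin

text \<open>
  The systems form a short exact sequence \<open>0 \<rightarrow> F \<rightarrow> T \<rightarrow> G \<rightarrow> 0\<close>, where \<open>T\<close> is the constant system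
  with value the group \<open>TN\<close>. Since \<open>U\<close> is directed, the first derived limit of \<open>T\<close> vanishes, and
  the long exact sequence identifies the first derived limit of \<open>F\<close> with the cokernel of
  \<open>TN \<rightarrow> lim G\<close>. Explicitly, extend \<open>\<epsilon>\<close> to a map \<open>g\<close> from \<open>T\<close> to \<open>I 0\<close>; then \<open>d 0 \<circ> g\<close> factors
  through \<open>G\<close>, and the connecting map sends a compatible family of cosets of \<open>a x\<close> to the class of
  the family \<open>d 0 x (g x (a x))\<close>.
\<close>

section \<open>Inverse limits and cohomology\<close>

lemma carrier_inv_lim:
  "s \<in> carrier (inv_lim J below A) \<longleftrightarrow>
     s \<in> (\<Pi>\<^sub>E x\<in>J. carrier (grp A x)) \<and> (\<forall>x\<in>J. \<forall>y\<in>J. below x y \<longrightarrow> tr A x y (s y) = s x)"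
  by (simp add: inv_lim_def)

lemma inv_limD:
  assumes "s \<in> carrier (inv_lim J below A)"
  shows "x \<in> J \<Longrightarrow> s x \<in> carrier (grp A x)"
    and "\<lbrakk>x \<in> J; y \<in> J; below x y\<rbrakk> \<Longrightarrow> tr A x y (s y) = s x"
  using assms by (auto simp: carrier_inv_lim)

lemma inv_limI:
  assumes "\<And>x. x \<in> J \<Longrightarrow> s x \<in> carrier (grp A x)"
    and "\<And>x y. \<lbrakk>x \<in> J; y \<in> J; below x y\<rbrakk> \<Longrightarrow> tr A x y (s y) = s x"
  shows "(\<lambda>x\<in>J. s x) \<in> carrier (inv_lim J below A)"
  using assms by (auto simp: carrier_inv_lim)

lemma mult_inv_lim: "s \<otimes>\<^bsub>inv_lim J below A\<^esub> t = (\<lambda>x\<in>J. s x \<otimes>\<^bsub>grp A x\<^esub> t x)"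
  by (simp add: inv_lim_def)

lemma one_inv_lim: "\<one>\<^bsub>inv_lim J below A\<^esub> = (\<lambda>x\<in>J. \<one>\<^bsub>grp A x\<^esub>)"
  by (simp add: inv_lim_def)

lemma inv_lim_eqI:
  assumes "s \<in> carrier (inv_lim J below A)" "t \<in> carrier (inv_lim J below A)"
    and "\<And>x. x \<in> J \<Longrightarrow> s x = t x"
  shows "s = t"
  using assms by (auto simp: carrier_inv_lim intro: PiE_ext)

section \<open>Group structure and functoriality of inverse limits\<close>

lemma inv_system_tr_group_hom:
  assumes A: "inv_system J below A" and xy: "x \<in> J" "y \<in> J" "below x y"
  shows "group_hom (grp A y) (grp A x) (tr A x y)"
  using inv_systemD(1)[OF A] inv_systemD(2)[OF A] xy
  by (simp add: group_hom_def group_hom_axioms_def comm_group.axioms)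

lemma system_hom_group_hom:
  assumes A: "inv_system J below A" and B: "inv_system J below B"
    and f: "system_hom J below A B f" and x: "x \<in> J"
  shows "group_hom (grp A x) (grp B x) (f x)"
  using inv_systemD(1)[OF A] inv_systemD(1)[OF B] system_homD(1)[OF f] x
  by (simp add: group_hom_def group_hom_axioms_def comm_group.axioms)

lemma inv_lim_comm_group:
  assumes A: "inv_system J below A"
  shows "comm_group (inv_lim J below A)"
proof -
  have cg: "comm_group (grp A x)" if "x \<in> J" for x
    using inv_systemD(1)[OF A that] .
  have gr: "group (grp A x)" if "x \<in> J" for x
    using cg[OF that] by (simp add: comm_group.axioms)
  have th: "group_hom (grp A y) (grp A x) (tr A x y)" if "x \<in> J" "y \<in> J" "below x y" for x y
    using inv_system_tr_group_hom[OF A that] .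
  show ?thesis
  proof (rule comm_groupI, goal_cases)
    case (1 s t)
    then show ?case
      unfolding mult_inv_lim
      using inv_limD[of _ J below A] group_hom.hom_mult[OF th] monoid.m_closed[OF group.is_monoid[OF gr]]
      by (intro inv_limI) auto
  next
    case 2
    show ?case
      unfolding one_inv_lim
      using group_hom.hom_one[OF th] monoid.one_closed[OF group.is_monoid[OF gr]]
      by (intro inv_limI) auto
  next
    case (3 s t u)
    then show ?case
      using inv_limD(1)[of _ J below A] monoid.m_assoc[OF group.is_monoid[OF gr]]
      by (auto simp: mult_inv_lim intro!: restrict_ext)
  next
    case (4 s t)
    then show ?case
      using inv_limD(1)[of _ J below A] comm_monoid.m_comm[OF comm_group.axioms(1)[OF cg]]
      by (auto simp: mult_inv_lim intro!: restrict_ext)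
  next
    case (5 s)
    then have "s \<in> extensional J" by (auto simp: carrier_inv_lim PiE_def)
    then show ?case
      using inv_limD(1)[OF 5] monoid.l_one[OF group.is_monoid[OF gr]]
      by (auto simp: mult_inv_lim one_inv_lim fun_eq_iff extensional_def)
  next
    case (6 s)
    have "(\<lambda>x\<in>J. inv\<^bsub>grp A x\<^esub> s x) \<in> carrier (inv_lim J below A)"
      using inv_limD[OF 6] group.inv_closed[OF gr] group_hom.hom_inv[OF th]
      by (intro inv_limI) auto
    moreover have "(\<lambda>x\<in>J. inv\<^bsub>grp A x\<^esub> s x) \<otimes>\<^bsub>inv_lim J below A\<^esub> s = \<one>\<^bsub>inv_lim J below A\<^esub>"
      using inv_limD(1)[OF 6] group.l_inv[OF gr]
      by (auto simp: mult_inv_lim one_inv_lim intro!: restrict_ext)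
    ultimately show ?case by blast
  qed
qed

lemma lim_map_hom:
  assumes A: "inv_system J below A" and f: "system_hom J below A B f"
  shows "lim_map J f \<in> hom (inv_lim J below A) (inv_lim J below B)"
proof (rule homI)
  fix s assume s: "s \<in> carrier (inv_lim J below A)"
  show "lim_map J f s \<in> carrier (inv_lim J below B)"
    unfolding lim_map_def
  proof (rule inv_limI)
    show "f x (s x) \<in> carrier (grp B x)" if "x \<in> J" for x
      using hom_in_carrier[OF system_homD(1)[OF f that] inv_limD(1)[OF s that]] .
    show "tr B x y (f y (s y)) = f x (s x)" if "x \<in> J" "y \<in> J" "below x y" for x y
      using system_homD(2)[OF f that inv_limD(1)[OF s that(2)]] inv_limD(2)[OF s that] by simp
  qed
next
  fix s t assume "s \<in> carrier (inv_lim J below A)" "t \<in> carrier (inv_lim J below A)"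
  then show "lim_map J f (s \<otimes>\<^bsub>inv_lim J below A\<^esub> t) =
      lim_map J f s \<otimes>\<^bsub>inv_lim J below B\<^esub> lim_map J f t"
    using hom_mult[OF system_homD(1)[OF f]] inv_limD(1)[of _ J below A]
    by (auto simp: lim_map_def mult_inv_lim intro!: restrict_ext)
qed

text \<open>First isomorphism theorem for \<open>h\<close> followed by the projection to
  \<open>Z Mod B\<close>. The map \<open>h\<close> itself may miss elements of \<open>Z\<close>: it
  suffices that every \<open>z\<close> differs from a value of \<open>h\<close> by an element of
  \<open>B\<close>. In the application \<open>Z\<close> consists of cocycles, \<open>B\<close> of
  coboundaries and \<open>h\<close> is the connecting map.\<close>

lemma (in group) hom_Mod_iso:
  assumes B: "B \<lhd> Z" and h: "h \<in> hom G Z"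
    and onto: "\<And>z. z \<in> carrier Z \<Longrightarrow> \<exists>b\<in>B. \<exists>c\<in>carrier G. z = b \<otimes>\<^bsub>Z\<^esub> h c"
  shows "Z Mod B \<cong> G Mod {c \<in> carrier G. h c \<in> B}"
proof -
  interpret B: normal B Z by (rule B)
  define p where "p c = B #>\<^bsub>Z\<^esub> h c" for c
  have hc: "h c \<in> carrier Z" if "c \<in> carrier G" for c
    using hom_in_carrier[OF h that] .
  have ph: "p \<in> hom G (Z Mod B)"
    using h B.r_coset_hom_Mod by (auto simp: hom_def p_def Pi_iff)
  interpret p: group_hom G "Z Mod B" p
    using ph is_group B.factorgroup_is_group by (simp add: group_hom_def group_hom_axioms_def)
  have "kernel G (Z Mod B) p = {c \<in> carrier G. h c \<in> B}"
    unfolding kernel_def p_def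
    using B.coset_join1[OF _ hc B.subgroup_axioms] B.coset_join2[OF hc B.subgroup_axioms] by auto
  moreover have "p ` carrier G = carrier (Z Mod B)"
  proof (intro equalityI subsetI)
    fix C assume "C \<in> carrier (Z Mod B)"
    then obtain z where z: "z \<in> carrier Z" "C = B #>\<^bsub>Z\<^esub> z" by (auto simp: carrier_FactGroup)
    then obtain b c where b: "b \<in> B" and c: "c \<in> carrier G" and "z = b \<otimes>\<^bsub>Z\<^esub> h c"
      using onto by blast
    then have "z \<in> B #>\<^bsub>Z\<^esub> h c" using B.rcosI[OF b B.subset hc[OF c]] by simp
    then have "C = p c"
      using B.repr_independence[OF _ hc[OF c] B.subgroup_axioms] z by (simp add: p_def)
    then show "C \<in> p ` carrier G" using c by blast
  qed (use p.hom_closed in auto)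
  ultimately show ?thesis
    using group.iso_sym[OF normal.factorgroup_is_group[OF p.normal_kernel] p.FactGroup_iso] by simp
qed

text \<open>The relation \<delta>\<delta> = 1 places the coboundaries inside the kernel, and in a
  commutative group of cocycles every subgroup is normal.\<close>

lemma cohomology_Suc_normal:
  assumes C: "\<And>n. comm_group (C n)" and \<delta>: "\<And>n. \<delta> n \<in> hom (C n) (C (Suc n))"
    and \<delta>\<delta>: "\<And>a. a \<in> carrier (C n) \<Longrightarrow> \<delta> (Suc n) (\<delta> n a) = \<one>\<^bsub>C (Suc (Suc n))\<^esub>"
  shows "\<delta> n ` carrier (C n) \<lhd>
    (C (Suc n))\<lparr>carrier := kernel (C (Suc n)) (C (Suc (Suc n))) (\<delta> (Suc n))\<rparr>" (is "_ \<lhd> ?Z")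
proof -
  have gh: "group_hom (C n) (C (Suc n)) (\<delta> n)" for n
    using C \<delta> by (simp add: group_hom_def group_hom_axioms_def comm_group.axioms)
  interpret c: comm_group "C (Suc n)" by (rule C)
  have K: "subgroup (kernel (C (Suc n)) (C (Suc (Suc n))) (\<delta> (Suc n))) (C (Suc n))"
    by (rule group_hom.subgroup_kernel[OF gh])
  have B: "subgroup (\<delta> n ` carrier (C n)) ?Z"
    using c.subgroup_incl[OF group_hom.img_is_subgroup[OF gh] K] \<delta>\<delta> hom_in_carrier[OF \<delta>]
    by (auto simp: kernel_def)
  have "comm_group ?Z"
    using subgroup.subgroup_is_group[OF K c.is_group] subgroup.mem_carrier[OF K] c.m_comm
    by (intro group.group_comm_groupI) auto
  then show ?thesis using comm_group.subgroup_imp_normal B by blast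
qed

section \<open>Systems of subgroups of a fixed group\<close>

text \<open>Both systems on the left of the short exact sequence have this form:
  \<open>F_sys\<close> comes from \<open>F_set\<close>, and the constant system from taking
  \<open>carrier M\<close> at every index, so facts proved once serve for both.\<close>

definition sub_sys :: "'a monoid \<Rightarrow> ('i \<Rightarrow> 'a set) \<Rightarrow> ('i, 'a) inv_sys" where
  "sub_sys M S = \<lparr>grp = (\<lambda>x. M\<lparr>carrier := S x\<rparr>), tr = (\<lambda>x y a. a)\<rparr>"

definition quot_sys :: "'a monoid \<Rightarrow> ('i \<Rightarrow> 'a set) \<Rightarrow> ('i, 'a set) inv_sys" where
  "quot_sys M S = \<lparr>grp = (\<lambda>x. M Mod S x), tr = (\<lambda>x y c. S x <#>\<^bsub>M\<^esub> c)\<rparr>"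

lemma sub_sys_simps [simp]:
  "carrier (grp (sub_sys M S) x) = S x"
  "a \<otimes>\<^bsub>grp (sub_sys M S) x\<^esub> b = a \<otimes>\<^bsub>M\<^esub> b"
  "tr (sub_sys M S) x y a = a"
  by (simp_all add: sub_sys_def)

lemma quot_sys_simps [simp]:
  "grp (quot_sys M S) x = M Mod S x"
  "tr (quot_sys M S) x y c = S x <#>\<^bsub>M\<^esub> c"
  by (simp_all add: quot_sys_def)

locale subgroup_system = comm_group M for M :: "'a monoid" (structure) +
  fixes J :: "'i set" and below :: "'i \<Rightarrow> 'i \<Rightarrow> bool" and S :: "'i \<Rightarrow> 'a set"
  assumes subgroup_S: "x \<in> J \<Longrightarrow> subgroup (S x) M"
    and antimono_S: "\<lbrakk>x \<in> J; y \<in> J; below x y\<rbrakk> \<Longrightarrow> S y \<subseteq> S x"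
begin

lemma sub_sys_inv_system: "inv_system J below (sub_sys M S)"
  unfolding inv_system_def
proof (intro conjI ballI impI)
  fix x assume x: "x \<in> J"
  show "comm_group (grp (sub_sys M S) x)"
    using subgroup.subgroup_is_group[OF subgroup_S[OF x] is_group] subgroup.mem_carrier[OF subgroup_S[OF x]] m_comm
    by (intro group.group_comm_groupI) (auto simp: sub_sys_def)
next
  fix x y assume "x \<in> J" "y \<in> J" "below x y"
  then show "tr (sub_sys M S) x y \<in> hom (grp (sub_sys M S) y) (grp (sub_sys M S) x)"
    using antimono_S by (intro homI) auto
qed auto

text \<open>Since \<open>S y\<close> is contained in \<open>S x\<close>, the product of the two
  subgroups is \<open>S x\<close>. Hence the transition maps of \<open>quot_sys\<close> fix
  representatives, and every check on that system reduces to representatives.\<close>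

lemma set_mult_rcoset:
  assumes "x \<in> J" "y \<in> J" "below x y" "a \<in> carrier M"
  shows "S x <#> (S y #> a) = S x #> a"
proof -
  interpret Sx: subgroup "S x" M by (rule subgroup_S[OF assms(1)])
  interpret Sy: subgroup "S y" M by (rule subgroup_S[OF assms(2)])
  have "S x <#> S y = S x"
  proof (intro equalityI subsetI)
    fix s assume s: "s \<in> S x"
    then have "s \<otimes> \<one> \<in> S x <#> S y" using Sy.one_closed unfolding set_mult_def by blast
    then show "s \<in> S x <#> S y" using Sx.mem_carrier[OF s] by simp
  next
    fix s assume "s \<in> S x <#> S y"
    then show "s \<in> S x"
      using Sx.m_closed antimono_S[OF assms(1-3)] unfolding set_mult_def by blast
  qed
  then show ?thesis
    using setmult_rcos_assoc[OF Sx.subset Sy.subset] assms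
    by simp
qed

lemma normal_S: "x \<in> J \<Longrightarrow> S x \<lhd> M"
  using subgroup_S subgroup_imp_normal by blast

lemma quot_sys_inv_system:
  assumes refl: "\<And>x. x \<in> J \<Longrightarrow> below x x"
    and trans: "\<And>x y z. \<lbrakk>x \<in> J; y \<in> J; z \<in> J; below x y; below y z\<rbrakk> \<Longrightarrow> below x z"
  shows "inv_system J below (quot_sys M S)"
  unfolding inv_system_def
proof (intro conjI ballI impI)
  fix x assume "x \<in> J"
  then show "comm_group (grp (quot_sys M S) x)"
    using abelian_FactGroup[OF subgroup_S] by simp
next
  fix x y assume xy: "x \<in> J" "y \<in> J" "below x y"
  show "tr (quot_sys M S) x y \<in> hom (grp (quot_sys M S) y) (grp (quot_sys M S) x)"
    using xy normal.rcos_sum[OF normal_S]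
    by (intro homI) (auto simp: carrier_FactGroup set_mult_rcoset)
next
  fix x C assume "x \<in> J" "C \<in> carrier (grp (quot_sys M S) x)"
  then show "tr (quot_sys M S) x x C = C"
    using refl by (auto simp: carrier_FactGroup set_mult_rcoset)
next
  fix x y z C
  assume xyz: "x \<in> J" "y \<in> J" "z \<in> J" "below x y" "below y z" and "C \<in> carrier (grp (quot_sys M S) z)"
  then show "tr (quot_sys M S) x y (tr (quot_sys M S) y z C) = tr (quot_sys M S) x z C"
    using trans[OF xyz] by (auto simp: carrier_FactGroup set_mult_rcoset)
qed

text \<open>
  The vanishing of the first cohomology of a directed set with coefficients in a constant system:
  a 1-cocycle \<open>\<phi>\<close> is the coboundary of \<open>x \<mapsto> \<phi> x z - \<phi> b z\<close>, where \<open>b\<close> is a fixed base point and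
  the choice of \<open>z\<close> above \<open>x\<close> and \<open>b\<close> does not matter.
\<close>

lemma cocycle_is_coboundary:
  assumes trans: "\<And>x y z. \<lbrakk>x \<in> J; y \<in> J; z \<in> J; below x y; below y z\<rbrakk> \<Longrightarrow> below x z"
    and dir: "\<And>x y. \<lbrakk>x \<in> J; y \<in> J\<rbrakk> \<Longrightarrow> \<exists>z\<in>J. below x z \<and> below y z"
    and closed: "\<And>x y. \<lbrakk>x \<in> J; y \<in> J; below x y\<rbrakk> \<Longrightarrow> \<phi> x y \<in> carrier M"
    and cocycle: "\<And>x y z. \<lbrakk>x \<in> J; y \<in> J; z \<in> J; below x y; below y z\<rbrakk> \<Longrightarrow> \<phi> x z = \<phi> x y \<otimes> \<phi> y z"
  shows "\<exists>\<alpha>. (\<forall>x\<in>J. \<alpha> x \<in> carrier M) \<and> (\<forall>x\<in>J. \<forall>y\<in>J. below x y \<longrightarrow> \<alpha> x = \<phi> x y \<otimes> \<alpha> y)"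
proof (cases "J = {}")
  case False
  then obtain b where b: "b \<in> J" by blast
  define \<alpha> where "\<alpha> x = (let z = SOME z. z \<in> J \<and> below x z \<and> below b z in \<phi> x z \<otimes> inv \<phi> b z)" for x
  have \<alpha>: "\<alpha> x = \<phi> x z \<otimes> inv \<phi> b z"
    if x: "x \<in> J" and z: "z \<in> J" "below x z" "below b z" for x z
  proof -
    define w where "w = (SOME z. z \<in> J \<and> below x z \<and> below b z)"
    have w: "w \<in> J \<and> below x w \<and> below b w"
      unfolding w_def by (rule someI_ex) (use dir[OF x b] in blast)
    \<comment> \<open>The chosen index \<open>w\<close> and the arbitrary index \<open>z\<close>
      need not be comparable; both are compared with a common upper bound \<open>u\<close>.\<close>
    obtain u where u: "u \<in> J" "below w u" "below z u" using dir w z by blast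
    have indep: "\<phi> x u \<otimes> inv \<phi> b u = \<phi> x v \<otimes> inv \<phi> b v"
      if v: "v \<in> J" "below x v" "below b v" "below v u" for v
    proof -
      have vc: "\<phi> x v \<in> carrier M" "\<phi> b v \<in> carrier M" "\<phi> v u \<in> carrier M"
        using closed x b v u by blast+
      have "\<phi> x u \<otimes> inv \<phi> b u = (\<phi> x v \<otimes> \<phi> v u) \<otimes> inv (\<phi> b v \<otimes> \<phi> v u)"
        using cocycle[OF x v(1) u(1) v(2,4)] cocycle[OF b v(1) u(1) v(3,4)] by simp
      also have "\<dots> = \<phi> x v \<otimes> (\<phi> v u \<otimes> (inv \<phi> v u \<otimes> inv \<phi> b v))"
        using vc by (simp add: inv_mult_group m_assoc)
      also have "\<dots> = \<phi> x v \<otimes> inv \<phi> b v"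
        using vc m_assoc[of "\<phi> v u" "inv \<phi> v u" "inv \<phi> b v"] by simp
      finally show ?thesis .
    qed
    have "\<alpha> x = \<phi> x w \<otimes> inv \<phi> b w" by (simp add: \<alpha>_def w_def Let_def)
    then show ?thesis using indep[of w] indep[of z] w z u by simp
  qed
  have "\<alpha> x \<in> carrier M" if "x \<in> J" for x
    using dir[OF that b] \<alpha>[OF that] closed that b by auto
  moreover have "\<alpha> x = \<phi> x y \<otimes> \<alpha> y" if xy: "x \<in> J" "y \<in> J" "below x y" for x y
  proof -
    \<comment> \<open>One index \<open>z\<close> above \<open>y\<close> and \<open>b\<close>
      computes both \<alpha> x and \<alpha> y, because it is above \<open>x\<close> too; the terms
      \<open>\<phi> b z\<close> then coincide.\<close>
    obtain z where z: "z \<in> J" "below y z" "below b z" using dir xy b by blast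
    then have "below x z" using trans xy by blast
    then show ?thesis using \<alpha> cocycle[OF xy(1,2) z(1) xy(3) z(2)] z xy b closed by (simp add: m_assoc)
  qed
  ultimately show ?thesis by blast
qed simp

section \<open>The first derived limit as a cokernel\<close>

theorem derived_lim_1_iso:
  fixes I :: "nat \<Rightarrow> ('i, 'b) inv_sys"
  assumes refl: "\<And>x. x \<in> J \<Longrightarrow> below x x"
    and trans: "\<And>x y z. \<lbrakk>x \<in> J; y \<in> J; z \<in> J; below x y; below y z\<rbrakk> \<Longrightarrow> below x z"
    and dir: "\<And>x y. \<lbrakk>x \<in> J; y \<in> J\<rbrakk> \<Longrightarrow> \<exists>z\<in>J. below x z \<and> below y z"
    and inf: "x0 \<in> J" "infinite (S x0)"
    and res: "injective_resolution J below (sub_sys M S) \<epsilon> I d"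
  shows "derived_lim J below I d 1 \<cong>
    inv_lim J below (quot_sys M S) Mod ((\<lambda>a. \<lambda>x\<in>J. S x #> a) ` carrier M)"
proof -
  let ?C = "sub_sys M (\<lambda>_ :: 'i. carrier M)"
  let ?L = "\<lambda>k. inv_lim J below (I k)" and ?\<delta> = "\<lambda>k. lim_map J (d k)"
  let ?G = "inv_lim J below (quot_sys M S)"
  have injI: "\<And>n. injective_system J below (I n)"
    and dh: "\<And>n. system_hom J below (I n) (I (Suc n)) (d n)"
    and \<epsilon>mono: "system_mono J below (sub_sys M S) (I 0) \<epsilon>"
    and ex0: "\<And>x. x \<in> J \<Longrightarrow> \<epsilon> x ` S x = kernel (grp (I 0) x) (grp (I (Suc 0)) x) (d 0 x)"
    and exS: "\<And>n x. x \<in> J \<Longrightarrow> d n x ` carrier (grp (I n) x) =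
        kernel (grp (I (Suc n)) x) (grp (I (Suc (Suc n))) x) (d (Suc n) x)"
    using res unfolding injective_resolution_def by simp_all
  have sysI: "inv_system J below (I n)" for n
    using injI unfolding injective_system_def by blast
  have \<epsilon>h: "system_hom J below (sub_sys M S) (I 0) \<epsilon>"
    and \<epsilon>inj: "\<And>x. x \<in> J \<Longrightarrow> inj_on (\<epsilon> x) (S x)"
    using \<epsilon>mono unfolding system_mono_def by simp_all
  interpret const: subgroup_system M J below "\<lambda>_. carrier M"
    by unfold_locales (auto simp: subgroup_self)
  \<comment> \<open>The infinite group \<open>S x0\<close> embeds into \<open>I 0\<close> by
    \<open>\<epsilon> x0\<close>. Infinity of the type \<open>'b\<close> is what permits testing
    injectivity of \<open>I 0\<close> on systems over the other type \<open>'a\<close>.\<close>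
  have infinite_b: "infinite (UNIV :: 'b set)"
    using finite_imageD[OF _ \<epsilon>inj] inf finite_subset[OF subset_UNIV] by blast
  have incl: "system_mono J below (sub_sys M S) ?C (\<lambda>x a. a)"
    using subgroup.mem_carrier[OF subgroup_S]
    by (auto simp: system_mono_def system_hom_def hom_def inj_on_def)
  have "\<exists>g. system_hom J below ?C (I 0) g \<and>
      (\<forall>x\<in>J. \<forall>a\<in>carrier (grp (sub_sys M S) x). g x a = \<epsilon> x a)"
    by (rule injective_system_extends[OF injI infinite_b _ _ sub_sys_inv_system
          const.sub_sys_inv_system incl \<epsilon>h])
      (use refl trans in blast)+
  then obtain g where gh: "system_hom J below ?C (I 0) g"
    and g\<epsilon>: "\<And>x a. x \<in> J \<Longrightarrow> a \<in> S x \<Longrightarrow> g x a = \<epsilon> x a"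
    by auto
  have ggh: "group_hom M (grp (I 0) x) (g x)" if "x \<in> J" for x
    using system_hom_group_hom[OF const.sub_sys_inv_system sysI gh that] by (simp add: sub_sys_def)
  have dgh: "group_hom (grp (I n) x) (grp (I (Suc n)) x) (d n x)" if "x \<in> J" for x n
    using system_hom_group_hom[OF sysI sysI dh that] .
  have tgh: "group_hom (grp (I n) y) (grp (I n) x) (tr (I n) x y)" if "x \<in> J" "y \<in> J" "below x y" for x y n
    using inv_system_tr_group_hom[OF sysI that] .
  have gc [simp]: "g x a \<in> carrier (grp (I 0) x)" if "x \<in> J" "a \<in> carrier M" for x a
    using group_hom.hom_closed[OF ggh] that by blast
  have gtr: "tr (I 0) x y (g y a) = g x a" if "x \<in> J" "y \<in> J" "below x y" "a \<in> carrier M" for x y a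
    using system_homD(2)[OF gh] that by simp
  have Sc: "a \<in> carrier M" if "x \<in> J" "a \<in> S x" for x a
    using subgroup.mem_carrier[OF subgroup_S] that by blast
  have dg: "d 0 x (g x a) = \<one>\<^bsub>grp (I (Suc 0)) x\<^esub>" if "x \<in> J" "a \<in> S x" for x a
    using ex0[OF that(1)] g\<epsilon>[OF that] that by (auto simp: kernel_def)
  have ker0: "\<exists>a\<in>S x. u = g x a"
    if "x \<in> J" "u \<in> carrier (grp (I 0) x)" "d 0 x u = \<one>\<^bsub>grp (I (Suc 0)) x\<^esub>" for x u
  proof -
    have "u \<in> \<epsilon> x ` S x" using ex0 that by (simp add: kernel_def)
    then show ?thesis using g\<epsilon> that by auto
  qed
  \<comment> \<open>Exactness at \<open>I 0\<close> in the form used below: two elements with equal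
    image under \<open>d 0 x\<close> differ by the image of some element of
    \<open>S x\<close>.\<close>
  have diff0: "\<exists>a\<in>S x. u = g x a \<otimes>\<^bsub>grp (I 0) x\<^esub> v"
    if x: "x \<in> J" and u: "u \<in> carrier (grp (I 0) x)" and v: "v \<in> carrier (grp (I 0) x)"
      and uv: "d 0 x u = d 0 x v" for x u v
  proof -
    interpret d: group_hom "grp (I 0) x" "grp (I (Suc 0)) x" "d 0 x" by (rule dgh[OF x])
    have "d 0 x (u \<otimes>\<^bsub>grp (I 0) x\<^esub> inv\<^bsub>grp (I 0) x\<^esub> v) = \<one>\<^bsub>grp (I (Suc 0)) x\<^esub>"
      using u v uv by simp
    then obtain a where "a \<in> S x" "u \<otimes>\<^bsub>grp (I 0) x\<^esub> inv\<^bsub>grp (I 0) x\<^esub> v = g x a"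
      using ker0[OF x] u v by blast
    moreover have "u = (u \<otimes>\<^bsub>grp (I 0) x\<^esub> inv\<^bsub>grp (I 0) x\<^esub> v) \<otimes>\<^bsub>grp (I 0) x\<^esub> v"
      using u v by (simp add: d.G.m_assoc)
    ultimately show ?thesis by metis
  qed
  \<comment> \<open>On \<open>S x\<close> the map \<open>g x\<close> equals
    \<open>\<epsilon> x\<close>, whose image is the kernel of \<open>d 0 x\<close>; so
    \<open>d 0 x\<close> after \<open>g x\<close> is constant on cosets and descends to the
    quotient.\<close>
  have "\<exists>q. q \<in> hom (M Mod S x) (grp (I (Suc 0)) x) \<and> (\<forall>a\<in>carrier M. q (S x #> a) = d 0 x (g x a))"
    if x: "x \<in> J" for x
  proof -
    interpret N: normal "S x" M using normal_S[OF x] .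
    interpret g: group_hom M "grp (I 0) x" "g x" by (rule ggh[OF x])
    interpret d: group_hom "grp (I 0) x" "grp (I (Suc 0)) x" "d 0 x" by (rule dgh[OF x])
    have comp: "(\<lambda>a. d 0 x (g x a)) \<in> hom M (grp (I (Suc 0)) x)" by (intro homI) auto
    have "d 0 x (g x a) = d 0 x (g x b)"
      if ab: "a \<in> carrier M" "b \<in> carrier M" "S x #> a = S x #> b" for a b
    proof -
      have "a \<in> S x #> b" using rcos_self[OF ab(1) N.subgroup_axioms] ab(3) by simp
      then obtain s where "s \<in> S x" "a = s \<otimes> b" by (auto simp: r_coset_def)
      then show ?thesis using dg[OF x] Sc[OF x] ab by simp
    qed
    then show ?thesis using FactGroup_universal[OF comp normal_S[OF x]] by metis
  qed
  then obtain q where qhom: "\<And>x. x \<in> J \<Longrightarrow> q x \<in> hom (M Mod S x) (grp (I (Suc 0)) x)"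
    and q: "\<And>x a. x \<in> J \<Longrightarrow> a \<in> carrier M \<Longrightarrow> q x (S x #> a) = d 0 x (g x a)"
    by metis
  have dtr: "tr (I (Suc 0)) x y (d 0 y u) = d 0 x (tr (I 0) x y u)"
    if "x \<in> J" "y \<in> J" "below x y" "u \<in> carrier (grp (I 0) y)" for x y u
    using system_homD(2)[OF dh[of 0]] that by simp
  have qsys: "system_hom J below (quot_sys M S) (I (Suc 0)) q"
    unfolding system_hom_def
    using qhom by (auto simp: carrier_FactGroup set_mult_rcoset q dtr gtr)
  let ?K = "kernel (?L (Suc 0)) (?L (Suc (Suc 0))) (?\<delta> (Suc 0))"
  let ?Z = "(?L (Suc 0))\<lparr>carrier := ?K\<rparr>" and ?B = "?\<delta> 0 ` carrier (?L 0)"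
  have Lcg: "comm_group (?L n)" for n by (rule inv_lim_comm_group[OF sysI])
  have \<delta>h: "?\<delta> n \<in> hom (?L n) (?L (Suc n))" for n by (rule lim_map_hom[OF sysI dh])
  have dd: "d (Suc n) x (d n x u) = \<one>\<^bsub>grp (I (Suc (Suc n))) x\<^esub>"
    if "x \<in> J" "u \<in> carrier (grp (I n) x)" for n x u
    using exS[OF that(1), of n] that by (auto simp: kernel_def)
  have normal_B: "?B \<lhd> ?Z"
    using cohomology_Suc_normal[of ?L ?\<delta> 0] Lcg \<delta>h dd inv_limD(1)[of _ J below "I 0"]
    by (simp add: lim_map_def one_inv_lim cong: restrict_cong)
  have K_iff: "k \<in> ?K \<longleftrightarrow> k \<in> carrier (?L (Suc 0)) \<and> (\<forall>x\<in>J. d (Suc 0) x (k x) = \<one>\<^bsub>grp (I (Suc (Suc 0))) x\<^esub>)" for k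
    by (auto simp: kernel_def lim_map_def one_inv_lim fun_eq_iff restrict_def)
  define h where "h = lim_map J q"
  have cosets: "\<exists>a\<in>carrier M. c x = S x #> a" if "c \<in> carrier ?G" "x \<in> J" for c x
    using inv_limD(1)[OF that] by (auto simp: carrier_FactGroup)
  interpret G: comm_group ?G by (rule inv_lim_comm_group[OF quot_sys_inv_system[OF refl trans]])
  have hG: "h \<in> hom ?G (?L (Suc 0))"
    unfolding h_def by (rule lim_map_hom[OF quot_sys_inv_system[OF refl trans] qsys])
  have hZ: "h \<in> hom ?G ?Z"
  proof -
    have "h c \<in> ?K" if c: "c \<in> carrier ?G" for c
      unfolding K_iff
    proof (intro conjI ballI)
      show "h c \<in> carrier (?L (Suc 0))" using hom_in_carrier[OF hG c] .
      fix x assume x: "x \<in> J"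
      obtain a where "a \<in> carrier M" "c x = S x #> a" using cosets[OF c x] by blast
      then show "d (Suc 0) x (h c x) = \<one>\<^bsub>grp (I (Suc (Suc 0))) x\<^esub>"
        using dd x by (simp add: h_def lim_map_def q)
    qed
    then show ?thesis using hG by (auto simp: hom_def)
  qed
  \<comment> \<open>The extension \<open>g x\<close> is known to be injective only on
    \<open>S x\<close>, where it agrees with \<open>\<epsilon> x\<close>. Each later cancellation of
    \<open>g x\<close> must therefore first place its arguments in \<open>S x\<close>.\<close>
  have ginj: "a = b" if "x \<in> J" "a \<in> S x" "b \<in> S x" "g x a = g x b" for x a b
    using inj_onD[OF \<epsilon>inj[OF that(1)]] g\<epsilon> that by simp
  have onto: "\<exists>b\<in>?B. \<exists>c\<in>carrier ?G. k = b \<otimes>\<^bsub>?Z\<^esub> h c" if k: "k \<in> carrier ?Z" for k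
  proof -
    have kL: "k \<in> carrier (?L (Suc 0))" and dk: "\<And>x. x \<in> J \<Longrightarrow> d (Suc 0) x (k x) = \<one>\<^bsub>grp (I (Suc (Suc 0))) x\<^esub>"
      using k K_iff[of k] by simp_all
    \<comment> \<open>Exactness at \<open>I 1\<close> lifts the cocycle \<open>k\<close> separately
      at each index; the lifts \<open>a x\<close> need not form a compatible family.\<close>
    have "\<exists>a. a \<in> carrier (grp (I 0) x) \<and> d 0 x a = k x" if x: "x \<in> J" for x
    proof -
      have "k x \<in> d 0 x ` carrier (grp (I 0) x)"
        using exS[OF x, of 0] inv_limD(1)[OF kL x] dk[OF x] by (simp add: kernel_def)
      then show ?thesis by auto
    qed
    then obtain a where ac: "\<And>x. x \<in> J \<Longrightarrow> a x \<in> carrier (grp (I 0) x)"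
      and da: "\<And>x. x \<in> J \<Longrightarrow> d 0 x (a x) = k x" by metis
    have atr: "tr (I 0) x y (a y) \<in> carrier (grp (I 0) x)" if "x \<in> J" "y \<in> J" "below x y" for x y
      using group_hom.hom_closed[OF tgh] ac that by blast
    \<comment> \<open>The defect of compatibility of the lifts lies in \<open>S x\<close>: both
      sides have the same image under \<open>d 0 x\<close> because \<open>k\<close> is
      compatible.\<close>
    have "\<exists>p\<in>S x. tr (I 0) x y (a y) = g x p \<otimes>\<^bsub>grp (I 0) x\<^esub> a x"
      if xy: "x \<in> J" "y \<in> J" "below x y" for x y
    proof -
      have "d 0 x (tr (I 0) x y (a y)) = tr (I (Suc 0)) x y (k y)"
        using dtr[OF xy ac[OF xy(2)]] da[OF xy(2)] by simp
      also have "\<dots> = d 0 x (a x)"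
        using inv_limD(2)[OF kL xy] da[OF xy(1)] by simp
      finally show ?thesis using diff0[OF xy(1) atr[OF xy] ac[OF xy(1)]] by blast
    qed
    then obtain \<phi> where \<phi>S: "\<And>x y. \<lbrakk>x \<in> J; y \<in> J; below x y\<rbrakk> \<Longrightarrow> \<phi> x y \<in> S x"
      and \<phi>: "\<And>x y. \<lbrakk>x \<in> J; y \<in> J; below x y\<rbrakk> \<Longrightarrow>
        tr (I 0) x y (a y) = g x (\<phi> x y) \<otimes>\<^bsub>grp (I 0) x\<^esub> a x"
      by metis
    have \<phi>c: "\<phi> x y \<in> carrier M" if "x \<in> J" "y \<in> J" "below x y" for x y
      using Sc[OF that(1) \<phi>S[OF that]] .
    \<comment> \<open>Transporting \<open>a z\<close> to \<open>x\<close> directly and through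
      \<open>y\<close> gives the same element. This yields the identity after applying
      \<open>g x\<close>, which can be cancelled since \<open>\<phi> y z\<close> belongs to
      \<open>S y\<close> and so to \<open>S x\<close>.\<close>
    have cocycle: "\<phi> x z = \<phi> x y \<otimes> \<phi> y z"
      if xyz: "x \<in> J" "y \<in> J" "z \<in> J" "below x y" "below y z" for x y z
    proof -
      have xz: "below x z" using trans[OF xyz] .
      interpret I0: comm_group "grp (I 0) x" by (rule inv_systemD(1)[OF sysI xyz(1)])
      interpret g: group_hom M "grp (I 0) x" "g x" by (rule ggh[OF xyz(1)])
      interpret t: group_hom "grp (I 0) y" "grp (I 0) x" "tr (I 0) x y" by (rule tgh[OF xyz(1,2,4)])
      have in_Sx: "\<phi> y z \<in> S x" using \<phi>S[OF xyz(2,3,5)] antimono_S[OF xyz(1,2,4)] by blast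
      have "g x (\<phi> x z) \<otimes>\<^bsub>grp (I 0) x\<^esub> a x = tr (I 0) x y (tr (I 0) y z (a z))"
        using \<phi>[OF xyz(1,3) xz] inv_systemD(4)[OF sysI xyz ac[OF xyz(3)]] by simp
      also have "\<dots> = g x (\<phi> y z) \<otimes>\<^bsub>grp (I 0) x\<^esub> (g x (\<phi> x y) \<otimes>\<^bsub>grp (I 0) x\<^esub> a x)"
        using \<phi> gtr xyz \<phi>c ac by simp
      also have "\<dots> = g x (\<phi> x y \<otimes> \<phi> y z) \<otimes>\<^bsub>grp (I 0) x\<^esub> a x"
        using xyz \<phi>c ac by (simp add: I0.m_ac)
      finally have "g x (\<phi> x z) = g x (\<phi> x y \<otimes> \<phi> y z)"
        using xyz xz \<phi>c ac by simp
      then show ?thesis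
        using ginj[OF xyz(1)] \<phi>S[OF xyz(1,3) xz] subgroup.m_closed[OF subgroup_S[OF xyz(1)] \<phi>S[OF xyz(1,2,4)] in_Sx]
        by blast
    qed
    \<comment> \<open>Here \<phi> is read as a cocycle with values in the whole of \<open>M\<close>.
      The resulting \<open>\<alpha> x\<close> may lie outside \<open>S x\<close>, and its coset is
      what survives in the quotient system.\<close>
    obtain \<alpha> where \<alpha>c: "\<And>x. x \<in> J \<Longrightarrow> \<alpha> x \<in> carrier M"
      and \<alpha>: "\<And>x y. \<lbrakk>x \<in> J; y \<in> J; below x y\<rbrakk> \<Longrightarrow> \<alpha> x = \<phi> x y \<otimes> \<alpha> y"
    proof -
      have "\<exists>\<alpha>. (\<forall>x\<in>J. \<alpha> x \<in> carrier M) \<and> (\<forall>x\<in>J. \<forall>y\<in>J. below x y \<longrightarrow> \<alpha> x = \<phi> x y \<otimes> \<alpha> y)"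
        by (rule cocycle_is_coboundary) (use trans dir \<phi>c cocycle in blast)+
      then show thesis using that by blast
    qed
    \<comment> \<open>Multiplying by \<open>g x (\<alpha> x)\<close> absorbs the defect \<phi> and
      makes the lifts compatible. This changes the image under \<open>d 0 x\<close> by
      \<open>d 0 x (g x (\<alpha> x))\<close>, which \<open>h c\<close> undoes; hence the inverse in
      \<open>c\<close>. The cosets in \<open>c\<close> are compatible because
      \<open>\<phi> x y\<close> lies in \<open>S x\<close>.\<close>
    define s where "s = (\<lambda>x\<in>J. g x (\<alpha> x) \<otimes>\<^bsub>grp (I 0) x\<^esub> a x)"
    define c where "c = (\<lambda>x\<in>J. S x #> inv \<alpha> x)"
    have s: "s \<in> carrier (?L 0)"
      unfolding s_def
    proof (rule inv_limI)
      fix x assume x: "x \<in> J"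
      interpret I0: comm_group "grp (I 0) x" by (rule inv_systemD(1)[OF sysI x])
      show "g x (\<alpha> x) \<otimes>\<^bsub>grp (I 0) x\<^esub> a x \<in> carrier (grp (I 0) x)"
        using x \<alpha>c ac by simp
    next
      fix x y assume xy: "x \<in> J" "y \<in> J" "below x y"
      interpret I0: comm_group "grp (I 0) x" by (rule inv_systemD(1)[OF sysI xy(1)])
      interpret g: group_hom M "grp (I 0) x" "g x" by (rule ggh[OF xy(1)])
      interpret t: group_hom "grp (I 0) y" "grp (I 0) x" "tr (I 0) x y" by (rule tgh[OF xy])
      have "tr (I 0) x y (g y (\<alpha> y) \<otimes>\<^bsub>grp (I 0) y\<^esub> a y)
          = g x (\<alpha> y) \<otimes>\<^bsub>grp (I 0) x\<^esub> (g x (\<phi> x y) \<otimes>\<^bsub>grp (I 0) x\<^esub> a x)"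
        using xy \<alpha>c ac gtr \<phi> by simp
      also have "\<dots> = g x (\<phi> x y \<otimes> \<alpha> y) \<otimes>\<^bsub>grp (I 0) x\<^esub> a x"
        using xy \<phi>c \<alpha>c ac by (simp add: I0.m_ac)
      finally show "tr (I 0) x y (g y (\<alpha> y) \<otimes>\<^bsub>grp (I 0) y\<^esub> a y) = g x (\<alpha> x) \<otimes>\<^bsub>grp (I 0) x\<^esub> a x"
        using \<alpha>[OF xy] by simp
    qed
    have c: "c \<in> carrier ?G"
      unfolding c_def
    proof (rule inv_limI)
      show "S x #> inv \<alpha> x \<in> carrier (grp (quot_sys M S) x)" if "x \<in> J" for x
        using that \<alpha>c by (auto simp: carrier_FactGroup)
      fix x y assume xy: "x \<in> J" "y \<in> J" "below x y"
      have "inv \<alpha> y = \<phi> x y \<otimes> inv \<alpha> x"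
        using \<alpha>[OF xy] \<alpha>c \<phi>c[OF xy] xy by (simp add: inv_mult m_assoc[symmetric])
      then have "inv \<alpha> y \<in> S x #> inv \<alpha> x"
        using rcosI[OF \<phi>S[OF xy] subgroup.subset[OF subgroup_S]] \<alpha>c xy by simp
      then have "S x #> inv \<alpha> y = S x #> inv \<alpha> x"
        using repr_independence[OF _ _ subgroup_S[OF xy(1)]] \<alpha>c[OF xy(1)] by simp
      then show "tr (quot_sys M S) x y (S y #> inv \<alpha> y) = S x #> inv \<alpha> x"
        using set_mult_rcoset[OF xy] \<alpha>c xy by simp
    qed
    have "k = ?\<delta> 0 s \<otimes>\<^bsub>?L (Suc 0)\<^esub> h c"
    proof (rule inv_lim_eqI[OF kL])
      interpret L1: comm_group "?L (Suc 0)" by (rule Lcg)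
      show "?\<delta> 0 s \<otimes>\<^bsub>?L (Suc 0)\<^esub> h c \<in> carrier (?L (Suc 0))"
        using hom_in_carrier[OF \<delta>h[of 0] s] hom_in_carrier[OF hG c] by simp
      fix x assume x: "x \<in> J"
      interpret g: group_hom M "grp (I 0) x" "g x" by (rule ggh[OF x])
      interpret d: group_hom "grp (I 0) x" "grp (I (Suc 0)) x" "d 0 x" by (rule dgh[OF x])
      interpret I1: comm_group "grp (I (Suc 0)) x" by (rule inv_systemD(1)[OF sysI x])
      have "d 0 x (g x (\<alpha> x) \<otimes>\<^bsub>grp (I 0) x\<^esub> a x) \<otimes>\<^bsub>grp (I (Suc 0)) x\<^esub> d 0 x (g x (inv \<alpha> x))
          = k x \<otimes>\<^bsub>grp (I (Suc 0)) x\<^esub> d 0 x (g x (\<alpha> x)) \<otimes>\<^bsub>grp (I (Suc 0)) x\<^esub> inv\<^bsub>grp (I (Suc 0)) x\<^esub> d 0 x (g x (\<alpha> x))"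
        using x \<alpha>c ac da[OF x, symmetric] by (simp add: I1.m_comm)
      also have "\<dots> = k x"
        using x \<alpha>c inv_limD(1)[OF kL x] by (simp add: d.H.m_assoc)
      finally show "k x = (?\<delta> 0 s \<otimes>\<^bsub>?L (Suc 0)\<^esub> h c) x"
        using x \<alpha>c by (simp add: mult_inv_lim lim_map_def s_def h_def c_def q)
    qed
    then show ?thesis using s c by auto
  qed
  have ker: "{c \<in> carrier ?G. h c \<in> ?B} = (\<lambda>a. \<lambda>x\<in>J. S x #> a) ` carrier M"
  proof (intro equalityI subsetI)
    fix c assume "c \<in> (\<lambda>a. \<lambda>x\<in>J. S x #> a) ` carrier M"
    then obtain a where a: "a \<in> carrier M" and c: "c = (\<lambda>x\<in>J. S x #> a)" by blast
    have "c \<in> carrier ?G"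
      unfolding c by (rule inv_limI) (use a in \<open>auto simp: carrier_FactGroup set_mult_rcoset\<close>)
    moreover have "h c = ?\<delta> 0 (\<lambda>x\<in>J. g x a)"
      using a by (auto simp: h_def lim_map_def c q intro!: restrict_ext)
    moreover have "(\<lambda>x\<in>J. g x a) \<in> carrier (?L 0)"
      by (rule inv_limI) (use a gtr in auto)
    ultimately show "c \<in> {c \<in> carrier ?G. h c \<in> ?B}" by blast
  next
    fix c assume "c \<in> {c \<in> carrier ?G. h c \<in> ?B}"
    then obtain s where c: "c \<in> carrier ?G" and s: "s \<in> carrier (?L 0)" and hc: "h c = ?\<delta> 0 s" by blast
    \<comment> \<open>An arbitrary representative matches \<open>s x\<close> only up to some
      \<open>t\<close> in \<open>S x\<close>. Moving \<open>t\<close> into the representative leaves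
      the coset unchanged and makes the match exact.\<close>
    have "\<exists>a\<in>carrier M. c x = S x #> a \<and> s x = g x a" if x: "x \<in> J" for x
    proof -
      interpret g: group_hom M "grp (I 0) x" "g x" by (rule ggh[OF x])
      obtain a where a: "a \<in> carrier M" "c x = S x #> a" using cosets[OF c x] by blast
      have "d 0 x (s x) = d 0 x (g x a)"
        using fun_cong[OF hc, of x] x a by (simp add: h_def lim_map_def q)
      then obtain t where t: "t \<in> S x" "s x = g x t \<otimes>\<^bsub>grp (I 0) x\<^esub> g x a"
        using diff0[OF x inv_limD(1)[OF s x] gc[OF x a(1)]] by blast
      have "t \<otimes> a \<in> S x #> a" using rcosI[OF t(1) subgroup.subset[OF subgroup_S[OF x]] a(1)] .
      then have "c x = S x #> (t \<otimes> a)"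
        using repr_independence[OF _ a(1) subgroup_S[OF x]] a(2) by simp
      then show ?thesis using t a Sc[OF x t(1)] by (intro bexI[of _ "t \<otimes> a"]) auto
    qed
    then obtain \<alpha> where \<alpha>c: "\<And>x. x \<in> J \<Longrightarrow> \<alpha> x \<in> carrier M"
      and c\<alpha>: "\<And>x. x \<in> J \<Longrightarrow> c x = S x #> \<alpha> x" and s\<alpha>: "\<And>x. x \<in> J \<Longrightarrow> s x = g x (\<alpha> x)"
      by metis
    \<comment> \<open>Compatibility of \<open>c\<close> gives equality up to some \<open>t\<close>
      in \<open>S x\<close>; compatibility of \<open>s\<close> shows that \<open>g x\<close> sends
      \<open>t\<close> to the identity, and injectivity on \<open>S x\<close> forces
      \<open>t\<close> to be trivial.\<close>
    have eq: "\<alpha> x = \<alpha> y" if xy: "x \<in> J" "y \<in> J" "below x y" for x y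
    proof -
      interpret g: group_hom M "grp (I 0) x" "g x" by (rule ggh[OF xy(1)])
      interpret Sx: subgroup "S x" M by (rule subgroup_S[OF xy(1)])
      have "S x #> \<alpha> y = S x #> \<alpha> x"
        using inv_limD(2)[OF c xy] set_mult_rcoset[OF xy] c\<alpha> \<alpha>c xy by simp
      then have "\<alpha> x \<in> S x #> \<alpha> y"
        using rcos_self[OF \<alpha>c[OF xy(1)] Sx.subgroup_axioms] by simp
      then obtain t where t: "t \<in> S x" "\<alpha> x = t \<otimes> \<alpha> y" by (auto simp: r_coset_def)
      have "g x (\<alpha> x) = g x (\<alpha> y)"
        using inv_limD(2)[OF s xy] s\<alpha> gtr \<alpha>c xy by simp
      then have "g x t = g x \<one>" using t \<alpha>c xy by simp
      then have "t = \<one>" using ginj[OF xy(1) t(1) Sx.one_closed] by blast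
      then show ?thesis using t \<alpha>c xy by simp
    qed
    \<comment> \<open>The values at \<open>x\<close> and at \<open>x0\<close> both equal the value
      at a common upper bound.\<close>
    have const_\<alpha>: "\<alpha> x = \<alpha> x0" if "x \<in> J" for x
      using dir[OF that inf(1)] eq inf(1) that by metis
    have "c \<in> extensional J" using c by (auto simp: carrier_inv_lim PiE_def)
    then have "c = (\<lambda>x\<in>J. S x #> \<alpha> x0)"
      using c\<alpha> const_\<alpha> by (intro extensionalityI[of _ J]) auto
    then show "c \<in> (\<lambda>a. \<lambda>x\<in>J. S x #> a) ` carrier M" using \<alpha>c[OF inf(1)] by blast
  qed
  have "?Z Mod ?B \<cong> ?G Mod ((\<lambda>a. \<lambda>x\<in>J. S x #> a) ` carrier M)"
    using G.hom_Mod_iso[OF normal_B hZ onto] unfolding ker .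
  moreover have "derived_lim J below I d 1 = ?Z Mod ?B"
    by (simp add: derived_lim_def cohomology_def)
  ultimately show ?thesis by simp
qed

end

section \<open>The subgroups F\<close>

lemma TN_comm_group: "comm_group TN"
proof (rule comm_groupI, goal_cases)
  case (6 \<alpha>)
  then have "(\<lambda>n. cnj (\<alpha> n)) \<in> carrier TN" by (simp add: TN_def)
  moreover have "cnj (\<alpha> n) * \<alpha> n = 1" for n
    using 6 complex_norm_square[of "\<alpha> n"] by (simp add: TN_def mult.commute)
  then have "(\<lambda>n. cnj (\<alpha> n)) \<otimes>\<^bsub>TN\<^esub> \<alpha> = \<one>\<^bsub>TN\<^esub>" by (simp add: TN_def)
  ultimately show ?case by blast
qed (auto simp: TN_def norm_mult mult_ac)

lemma inv_TN:
  assumes "\<alpha> \<in> carrier TN"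
  shows "inv\<^bsub>TN\<^esub> \<alpha> = (\<lambda>n. cnj (\<alpha> n))"
proof -
  interpret comm_group TN by (rule TN_comm_group)
  have "cnj (\<alpha> n) * \<alpha> n = 1" for n
    using assms complex_norm_square[of "\<alpha> n"] by (simp add: TN_def mult.commute)
  then show ?thesis
    using assms by (intro inv_equality) (auto simp: TN_def)
qed

section \<open>Blocks of two consecutive segments and the groups \<open>F_set\<close>\<close>

lemma strict_mono_nth_pt: "infinite X \<Longrightarrow> strict_mono (nth_pt X)"
  by (simp add: strict_mono_def nth_pt_def)

lemma nth_pt_in: "infinite X \<Longrightarrow> nth_pt X j \<in> insert 0 X"
  unfolding nth_pt_def by (rule enumerate_in_set) simp

lemma nth_pt_Suc_le:
  assumes "infinite X" "a \<in> X" "nth_pt X j < a"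
  shows "nth_pt X (Suc j) \<le> a"
  unfolding nth_pt_def
  by (subst enumerate_Suc'') (use assms in \<open>auto simp: nth_pt_def intro: Least_le\<close>)

lemma seg_Un_seg_Suc:
  assumes "infinite X"
  shows "seg X j \<union> seg X (Suc j) = {nth_pt X j..<nth_pt X (Suc (Suc j))}"
  using strict_mono_nth_pt[OF assms]
  by (auto simp: seg_def strict_mono_def intro: ivl_disj_un_two(3)) (meson lessI less_trans not_le order.strict_trans1)+

lemma Delta_less_iff:
  assumes "finite K" "K \<noteq> {}"
  shows "Delta K \<alpha> \<beta> < e \<longleftrightarrow> (\<forall>i\<in>K. \<forall>j\<in>K. cmod (\<alpha> i * cnj (\<alpha> j) - \<beta> i * cnj (\<beta> j)) < e)"
proof -
  have "{cmod (\<alpha> i * cnj (\<alpha> j) - \<beta> i * cnj (\<beta> j)) |i j. i \<in> K \<and> j \<in> K} =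
      (\<lambda>(i, j). cmod (\<alpha> i * cnj (\<alpha> j) - \<beta> i * cnj (\<beta> j))) ` (K \<times> K)"
    by auto
  then show ?thesis
    unfolding Delta_def using assms by (subst Max_less_iff) auto
qed

lemma Delta_nonneg:
  assumes "finite K" "K \<noteq> {}"
  shows "0 \<le> Delta K \<alpha> \<beta>"
  using assms Delta_less_iff[OF assms, of \<alpha> \<beta> "0 :: real"] by (force simp: not_less[symmetric])

text \<open>Each block is finite and nonempty, so a strict bound on the maximum is a strict bound on
  every pair, and the limit condition becomes a pairwise estimate.\<close>

lemma F_set_iff:
  assumes X: "infinite X"
  shows "\<alpha> \<in> F_set X \<longleftrightarrow> \<alpha> \<in> carrier TN \<and>
    (\<forall>e>0. \<exists>N. \<forall>j\<ge>N. \<forall>i\<in>{nth_pt X j..<nth_pt X (Suc (Suc j))}.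
       \<forall>i'\<in>{nth_pt X j..<nth_pt X (Suc (Suc j))}. cmod (\<alpha> i * cnj (\<alpha> i') - 1) < e)"
proof -
  let ?K = "\<lambda>j. {nth_pt X j..<nth_pt X (Suc (Suc j))}"
  have K: "finite (?K j)" "?K j \<noteq> {}" for j
    using strict_mono_nth_pt[OF X] by (auto simp: strict_mono_def)
  have "dist (Delta (?K j) \<alpha> (\<lambda>_. 1)) 0 < e \<longleftrightarrow>
      (\<forall>i\<in>?K j. \<forall>i'\<in>?K j. cmod (\<alpha> i * cnj (\<alpha> i') - 1) < e)" for j e
    using Delta_less_iff[OF K, of j \<alpha> "\<lambda>_. 1" e] Delta_nonneg[OF K, of j \<alpha> "\<lambda>_. 1"]
    by (simp add: dist_real_def)
  then show ?thesis
    by (simp add: F_set_def seg_Un_seg_Suc[OF X] LIMSEQ_def)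
qed

lemma F_set_subgroup:
  assumes X: "infinite X"
  shows "subgroup (F_set X) TN"
proof -
  interpret comm_group TN by (rule TN_comm_group)
  let ?K = "\<lambda>j. {nth_pt X j..<nth_pt X (Suc (Suc j))}"
  show ?thesis
  proof (rule subgroupI)
    show "F_set X \<subseteq> carrier TN" by (auto simp: F_set_def)
    have "\<one>\<^bsub>TN\<^esub> \<in> F_set X" unfolding F_set_iff[OF X] by (auto simp: TN_def)
    then show "F_set X \<noteq> {}" by blast
  next
    fix \<alpha> assume \<alpha>: "\<alpha> \<in> F_set X"
    then have T: "\<alpha> \<in> carrier TN" by (simp add: F_set_def)
    have "cmod (cnj (\<alpha> i) * cnj (cnj (\<alpha> i')) - 1) = cmod (\<alpha> i * cnj (\<alpha> i') - 1)" for i i'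
      using complex_mod_cnj[of "\<alpha> i * cnj (\<alpha> i') - 1"] by simp
    then show "inv\<^bsub>TN\<^esub> \<alpha> \<in> F_set X"
      using \<alpha> T unfolding inv_TN[OF T] F_set_iff[OF X] by (simp add: TN_def)
  next
    fix \<alpha> \<beta> assume \<alpha>: "\<alpha> \<in> F_set X" and \<beta>: "\<beta> \<in> F_set X"
    then have T: "\<alpha> \<in> carrier TN" "\<beta> \<in> carrier TN" by (simp_all add: F_set_def)
    \<comment> \<open>For unimodular u and v, write uv - 1 as (u - 1)v + (v - 1); the factor v does
      not change the modulus.\<close>
    have tri: "cmod ((\<alpha> i * \<beta> i) * cnj (\<alpha> i' * \<beta> i') - 1)
        \<le> cmod (\<alpha> i * cnj (\<alpha> i') - 1) + cmod (\<beta> i * cnj (\<beta> i') - 1)" for i i'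
    proof -
      have "(\<alpha> i * \<beta> i) * cnj (\<alpha> i' * \<beta> i') - 1 =
          (\<alpha> i * cnj (\<alpha> i') - 1) * (\<beta> i * cnj (\<beta> i')) + (\<beta> i * cnj (\<beta> i') - 1)"
        by (simp add: algebra_simps)
      moreover have "cmod (\<beta> i * cnj (\<beta> i')) = 1" using T by (simp add: TN_def norm_mult)
      ultimately show ?thesis by (metis norm_triangle_ineq norm_mult mult.right_neutral)
    qed
    have "\<exists>N. \<forall>j\<ge>N. \<forall>i\<in>?K j. \<forall>i'\<in>?K j. cmod ((\<alpha> i * \<beta> i) * cnj (\<alpha> i' * \<beta> i') - 1) < e"
      if "e > 0" for e
    proof -
      have e2: "e / 2 > 0" using that by simp
      obtain N1 N2 where
        1: "\<And>j i i'. \<lbrakk>j \<ge> N1; i \<in> ?K j; i' \<in> ?K j\<rbrakk> \<Longrightarrow> cmod (\<alpha> i * cnj (\<alpha> i') - 1) < e / 2" and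
        2: "\<And>j i i'. \<lbrakk>j \<ge> N2; i \<in> ?K j; i' \<in> ?K j\<rbrakk> \<Longrightarrow> cmod (\<beta> i * cnj (\<beta> i') - 1) < e / 2"
        using \<alpha> \<beta> e2 unfolding F_set_iff[OF X] by meson
      have "cmod ((\<alpha> i * \<beta> i) * cnj (\<alpha> i' * \<beta> i') - 1) < e"
        if "j \<ge> max N1 N2" "i \<in> ?K j" "i' \<in> ?K j" for j i i'
        using tri[of i i'] 1[of j i i'] 2[of j i i'] that by linarith
      then show ?thesis by blast
    qed
    then show "\<alpha> \<otimes>\<^bsub>TN\<^esub> \<beta> \<in> F_set X"
      using m_closed[OF T] unfolding F_set_iff[OF X] by (simp add: TN_def)
  qed
qed

text \<open>Constant sequences have zero oscillation on every block, and the constants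
  \<open>cis t\<close> with \<open>t\<close> in [0,1] are distinct. This supplies the infinite
  component that the general theorem asks for.\<close>

lemma F_set_infinite:
  assumes X: "infinite X"
  shows "infinite (F_set X)"
proof -
  have "(\<lambda>_. cis t) \<in> F_set X" for t
    unfolding F_set_iff[OF X] by (auto simp: TN_def cis_cnj cis_mult)
  then have "(\<lambda>t _. cis t) ` {0..1} \<subseteq> F_set X" by blast
  moreover have "inj_on (\<lambda>t (_ :: nat). cis t) {0..1}"
  proof (rule inj_onI)
    fix s t :: real assume st: "s \<in> {0..1}" "t \<in> {0..1}" "(\<lambda>_ :: nat. cis s) = (\<lambda>_. cis t)"
    then have "cos s = cos t" by (metis cis.sel(1))
    then show "s = t" using st cos_inj_pi[of s t] pi_ge_two by simp
  qed
  moreover have "infinite {0..1 :: real}" by (simp add: infinite_Icc)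
  ultimately show ?thesis using finite_imageD finite_subset by blast
qed

lemma F_set_antimono:
  assumes X: "infinite X" and Y: "infinite Y" and XY: "almost_sup X Y"
  shows "F_set Y \<subseteq> F_set X"
proof
  fix \<alpha> assume \<alpha>: "\<alpha> \<in> F_set Y"
  obtain B where B: "\<And>y. y \<in> Y - X \<Longrightarrow> y \<le> B"
    using XY finite_nat_set_iff_bounded_le[of "Y - X"] unfolding almost_sup_def by blast
  note mX = strict_mono_nth_pt[OF X] and mY = strict_mono_nth_pt[OF Y]
  \<comment> \<open>Beyond \<open>B\<close>, two consecutive segments of \<open>X\<close> contain at most one point of \<open>Y\<close> in their
    interior, so they are covered by two consecutive segments of \<open>Y\<close>.\<close>
  have cover: "\<exists>k\<ge>k0. {nth_pt X j..<nth_pt X (Suc (Suc j))} \<subseteq> {nth_pt Y k..<nth_pt Y (Suc (Suc k))}"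
    if j: "j \<ge> max B (nth_pt Y k0)" for j k0
  proof -
    have jX: "j \<le> nth_pt X j" using strict_mono_imp_increasing[OF mX] .
    \<comment> \<open>The last point of \<open>Y\<close> that does not exceed the left end of the
      block of \<open>X\<close>; it exists because \<open>nth_pt Y\<close> is strictly increasing,
      and \<open>j\<close> is large enough to give \<open>k0 \<le> k\<close>.\<close>
    define k where "k = (GREATEST k. nth_pt Y k \<le> nth_pt X j)"
    have bound: "k' \<le> nth_pt X j" if "nth_pt Y k' \<le> nth_pt X j" for k'
      using strict_mono_imp_increasing[OF mY, of k'] that by linarith
    have k: "nth_pt Y k \<le> nth_pt X j"
      unfolding k_def by (rule GreatestI_nat[of _ k0]) (use j jX bound in auto)
    have max_k: "k' \<le> k" if "nth_pt Y k' \<le> nth_pt X j" for k'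
      unfolding k_def by (rule Greatest_le_nat) (use that bound in auto)
    have "k0 \<le> k" using max_k j jX by simp
    \<comment> \<open>Such a point exceeds \<open>B\<close>, hence lies in \<open>X\<close> as soon
      as it lies in \<open>Y\<close>; being positive, it is not the adjoined point 0.\<close>
    have Yk: "nth_pt Y m \<in> X" if "nth_pt Y m > nth_pt X j" for m
      using that nth_pt_in[OF Y, of m] B[of "nth_pt Y m"] j jX by fastforce
    \<comment> \<open>The next two points of \<open>Y\<close> lie in \<open>X\<close>. The first is
      at least the next point of \<open>X\<close>, and the second, being strictly larger, is at
      least the one after that.\<close>
    have s1: "nth_pt Y (Suc k) > nth_pt X j" using max_k[of "Suc k"] by force
    then have "nth_pt X (Suc j) \<le> nth_pt Y (Suc k)" using nth_pt_Suc_le[OF X Yk] by blast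
    then have s2: "nth_pt Y (Suc (Suc k)) > nth_pt X (Suc j)"
      using strict_monoD[OF mY, of "Suc k" "Suc (Suc k)"] by simp
    then have "nth_pt X (Suc (Suc j)) \<le> nth_pt Y (Suc (Suc k))"
      using nth_pt_Suc_le[OF X Yk] strict_monoD[OF mX, of j "Suc j"] by simp
    then show ?thesis using k \<open>k0 \<le> k\<close> by (intro exI[of _ k]) auto
  qed
  have "\<exists>N. \<forall>j\<ge>N. \<forall>i\<in>{nth_pt X j..<nth_pt X (Suc (Suc j))}.
       \<forall>i'\<in>{nth_pt X j..<nth_pt X (Suc (Suc j))}. cmod (\<alpha> i * cnj (\<alpha> i') - 1) < e" if e: "e > 0" for e
  proof -
    obtain k0 where k0: "\<forall>k\<ge>k0. \<forall>i\<in>{nth_pt Y k..<nth_pt Y (Suc (Suc k))}.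
       \<forall>i'\<in>{nth_pt Y k..<nth_pt Y (Suc (Suc k))}. cmod (\<alpha> i * cnj (\<alpha> i') - 1) < e"
      using \<alpha> e unfolding F_set_iff[OF Y] by blast
    show ?thesis
    proof (intro exI[of _ "max B (nth_pt Y k0)"] allI impI ballI)
      fix j i i'
      assume j: "max B (nth_pt Y k0) \<le> j" and "i \<in> {nth_pt X j..<nth_pt X (Suc (Suc j))}"
        "i' \<in> {nth_pt X j..<nth_pt X (Suc (Suc j))}"
      then show "cmod (\<alpha> i * cnj (\<alpha> i') - 1) < e" using cover[OF j] k0 by blast
    qed
  qed
  then show "\<alpha> \<in> F_set X" using \<alpha> unfolding F_set_iff[OF X] F_set_iff[OF Y] by blast
qed

lemma almost_sup_trans: "almost_sup X Y \<Longrightarrow> almost_sup Y Z \<Longrightarrow> almost_sup X Z"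
  unfolding almost_sup_def by (rule finite_subset[of _ "(Y - X) \<union> (Z - Y)"]) auto

text \<open>The index set \<open>Field (cardSuc natLeq)\<close> encodes the ordinals below omega_1.
  The resolution is an arbitrary one over an arbitrary type \<open>'b\<close>, so the isomorphism
  holds for every choice used to compute the derived limit.\<close>

theorem proposition3p3:
  fixes U :: "nat set set"
    and I :: "nat \<Rightarrow> (nat set, 'b) inv_sys"
    and d :: "nat \<Rightarrow> nat set \<Rightarrow> 'b \<Rightarrow> 'b"
    and \<epsilon> :: "nat set \<Rightarrow> (nat \<Rightarrow> complex) \<Rightarrow> 'b"
  assumes "\<And>X. X \<in> U \<Longrightarrow> infinite X"
    and "\<And>X Y. X \<in> U \<Longrightarrow> Y \<in> U \<Longrightarrow> X \<inter> Y \<in> U"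
    and "\<And>X Y. X \<in> U \<Longrightarrow> finite ((X - Y) \<union> (Y - X)) \<Longrightarrow> Y \<in> U"
    and "\<exists>Xi. (\<forall>\<xi> \<in> Field (cardSuc natLeq). Xi \<xi> \<in> U) \<and>
              (\<forall>X\<in>U. \<exists>\<xi> \<in> Field (cardSuc natLeq). almost_sup X (Xi \<xi>))"
    and "\<And>f :: nat \<Rightarrow> nat. \<exists>X\<in>U. \<forall>\<^sub>F i in sequentially. f i \<le> nth_pt X i"
    and "injective_resolution U almost_sup F_sys \<epsilon> I d"
  shows "derived_lim U almost_sup I d 1 \<cong>
         inv_lim U almost_sup G_sys Mod (diag U ` carrier TN)"
proof -
  interpret comm_group TN by (rule TN_comm_group)
  interpret subgroup_system TN U almost_sup F_set
    by (rule subgroup_system.intro[OF comm_group_axioms subgroup_system_axioms.intro])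
      (use assms(1) F_set_subgroup F_set_antimono in blast)+
  \<comment> \<open>The domination condition, applied to any function, shows that \<open>U\<close>
    is nonempty.\<close>
  obtain X0 where X0: "X0 \<in> U" using assms(5) by blast
  have F: "F_sys = sub_sys TN F_set" and G: "G_sys = quot_sys TN F_set"
    by (simp_all add: F_sys_def G_sys_def sub_sys_def quot_sys_def)
  have D: "diag U = (\<lambda>\<alpha>. \<lambda>X\<in>U. F_set X #>\<^bsub>TN\<^esub> \<alpha>)"
    by (simp add: diag_def fun_eq_iff)
  show ?thesis
    unfolding G D
  proof (rule derived_lim_1_iso[OF _ _ _ X0 F_set_infinite[OF assms(1)[OF X0]] assms(6)[unfolded F]])
    show "almost_sup X X" for X by (simp add: almost_sup_def)
    show "almost_sup X Z" if "almost_sup X Y" "almost_sup Y Z" for X Y Z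
      using almost_sup_trans that .
    \<comment> \<open>Smaller sets come later, so the intersection is an upper bound.\<close>
    show "\<exists>Z\<in>U. almost_sup X Z \<and> almost_sup Y Z" if "X \<in> U" "Y \<in> U" for X Y
      using assms(2)[OF that] by (intro bexI[of _ "X \<inter> Y"]) (simp_all add: almost_sup_def Diff_eq_empty_iff[THEN iffD2])
  qed
qed

end
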